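(* For every integer $k\geq 3$ there exist a real number $\beta>0$ and a positive integer $s_0$ such that the following holds. Let $n,s$ be integers with $s>s_0$ and $ks+k\leq n\leq (1+\beta)ks+k-2$. Suppose that $\mathcal{F}\subseteq \binom{[n]}{k}$ is non-trivial and $\nu(\mathcal{F})\leq s$. Then $$|\mathcal{F}|\leq \max\{|\mathcal{E}_0(n,k,s)|,|\mathcal{E}_1(n,k,s)|\}.$$
   Context: $[n]=\{1,\dots,n\}$ and $\binom{[n]}{k}$ is the set of all $k$-element subsets of $[n]$; a $k$-graph on $[n]$ is a family $\mathcal{F}\subseteq\binom{[n]}{k}$. $\nu(\mathcal{F})$ is the matching number of $\mathcal{F}$, i.e. the maximum number of pairwise disjoint members of $\mathcal{F}$. $\mathcal{F}$ is called non-trivial if it has no isolated vertex, i.e. every element of $[n]$ lies in some member of $\mathcal{F}$. For integers $a\le b$, $[a,b]=\{a,a+1,\dots,b\}$. Define $$\mathcal{E}_0(n,k,s)=\binom{[ks+k-2]}{k}\cup\left\{A\in \binom{[n]}{k}: A\setminus [ks+k-2]=\{ks+k-1\},\ A\cap [k-1]\neq \emptyset\right\}\cup\left\{[k-1]\cup \{x\}:ks+k\leq x\leq n\right\}$$ and $$\mathcal{E}_1(n,k,s)=\binom{[ks+k-2]}{k}\cup\bigcup_{x\in [ks+k-1,n]}\left\{A\in \binom{[n]}{k}: A\setminus [ks+k-2]=\{x\},\ 1\in A\right\}.$$ *)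

theory Defs
  imports Complex_Main "HOL-Library.Ramsey"
begin

text \<open>The set of \<open>k\<close>-element subsets of \<open>[n] = {1, \<dots>, n}\<close> is \<^term>\<open>nsets {1..n} k\<close>.
  The truncated subtractions below are harmless for \<open>k \<ge> 2\<close>.\<close>

definition matching_number :: "'a set set \<Rightarrow> nat" where
  "matching_number F = Max {card M | M. M \<subseteq> F \<and> pairwise disjnt M}"

definition nontrivial :: "nat \<Rightarrow> nat set set \<Rightarrow> bool" where
  "nontrivial n F \<longleftrightarrow> (\<forall>x \<in> {1..n}. \<exists>A \<in> F. x \<in> A)"

definition E0 :: "nat \<Rightarrow> nat \<Rightarrow> nat \<Rightarrow> nat set set" where
  "E0 n k s =
     nsets {1..k*s + k - 2} k
     \<union> {A \<in> nsets {1..n} k. A - {1..k*s + k - 2} = {k*s + k - 1} \<and> A \<inter> {1..k - 1} \<noteq> {}}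
     \<union> {{1..k - 1} \<union> {x} | x. k*s + k \<le> x \<and> x \<le> n}"

definition E1 :: "nat \<Rightarrow> nat \<Rightarrow> nat \<Rightarrow> nat set set" where
  "E1 n k s =
     nsets {1..k*s + k - 2} k
     \<union> (\<Union>x \<in> {k*s + k - 1..n}. {A \<in> nsets {1..n} k. A - {1..k*s + k - 2} = {x} \<and> 1 \<in> A})"

end

theory Submission
  imports Defs "HOL-Combinatorics.Permutations"
begin

text \<open>
  Put \<open>N = ks + k - 2\<close>. Averaging over random collections of disjoint \<open>k\<close>-sets shows that whenever a
  few members of \<open>F\<close> cannot be completed to \<open>s + 1\<close> disjoint ones inside \<open>{1..N}\<close>, many \<open>k\<close>-subsets
  of \<open>{1..N}\<close> are missing from \<open>F\<close>.

  For a shifted family there are two cases. If fewer than about \<open>N\<^bsup>k-1\<^esup>/(k - 1)!\<close> sets are missing, then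
  no member has two vertices outside \<open>{1..N}\<close>, and the links of \<open>N + 1\<close> and \<open>N + 2\<close> are
  cross-intersecting, which bounds the members leaving \<open>{1..N}\<close> as in \<open>E0\<close> or \<open>E1\<close>. Otherwise let \<open>p\<close>
  be maximal such that \<open>{p..p + k - 2} \<union> {N + 1}\<close> is a member: all members leaving \<open>{1..N}\<close> meet
  \<open>{1..p}\<close>, so there are \<open>O(p (n - N) n\<^bsup>k-2\<^esup>)\<close> of them, whereas at least of order \<open>p N\<^bsup>k-1\<^esup>\<close> sets are
  missing; for \<open>n - N\<close> at most a small multiple of \<open>N\<close> the missing sets win.

  Shifting may isolate a vertex. A family minimal with respect to shifting is either shifted, or one
  shift of it is a non-trivial family on \<open>n - 1\<close> vertices and induction on \<open>n\<close> applies. The induction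
  starts at \<open>n = N + 2\<close>: if the shift towards \<open>a\<close> isolates \<open>b\<close>, the links of \<open>a\<close> and \<open>b\<close> are disjoint. Then
  we shift only among the other \<open>N\<close> vertices. If this isolates the last of them, disjointness of the
  links gives the bound; if not, \<open>{1..k - 1}\<close> is joined to every further vertex, all remaining shifts
  preserve this, and we arrive at a non-trivial shifted family.
\<close>

text \<open>A bound without \<open>Max\<close>, so that it applies directly to a single matching. An
  infinite \<open>M\<close> has cardinality 0, which is harmless as all families here are
  finite.\<close>

definition matching_le :: "'a set set \<Rightarrow> nat \<Rightarrow> bool" where
  "matching_le F s \<longleftrightarrow> (\<forall>M. M \<subseteq> F \<longrightarrow> pairwise disjnt M \<longrightarrow> card M \<le> s)"

lemma matching_le_matching_number:
  assumes "finite F" "matching_number F \<le> s"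
  shows "matching_le F s"
proof -
  have fin: "finite {card M | M. M \<subseteq> F \<and> pairwise disjnt M}"
    using assms(1) by (auto intro: finite_subset[of _ "card ` Pow F"])
  show ?thesis unfolding matching_le_def
  proof (intro allI impI)
    fix M assume "M \<subseteq> F" "pairwise disjnt M"
    then have "card M \<le> matching_number F"
      unfolding matching_number_def by (intro Max_ge[OF fin]) auto
    then show "card M \<le> s" using assms(2) by simp
  qed
qed

subsection \<open>Averaging over disjoint sets\<close>

lemma ex_permutes_image:
  assumes "finite R" "C \<subseteq> R" "D \<subseteq> R" "card C = card D"
  shows "\<exists>p. p permutes R \<and> p ` C = D"
proof -
  have fin: "finite C" "finite D" using assms finite_subset by blast+
  obtain f where f: "bij_betw f C D"
    using fin assms(4) finite_same_card_bij by blast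
  have "card (R - C) = card (R - D)"
    using assms fin by (simp add: card_Diff_subset)
  then obtain g where g: "bij_betw g (R - C) (R - D)"
    using assms(1) finite_same_card_bij by (metis finite_Diff)
  define p where "p x = (if x \<in> C then f x else if x \<in> R then g x else x)" for x
  have pC: "bij_betw p C D" using f by (subst bij_betw_cong[of _ _ f]) (auto simp: p_def)
  have "bij_betw p (R - C) (R - D)"
    using g by (subst bij_betw_cong[of _ _ g]) (auto simp: p_def)
  then have "bij_betw p (C \<union> (R - C)) (D \<union> (R - D))"
    using pC by (intro bij_betw_combine) auto
  then have "bij_betw p R R" using assms by (simp add: Un_absorb1)
  then have "p permutes R"
    by (rule bij_imp_permutes) (use assms in \<open>auto simp: p_def\<close>)
  then show ?thesis using pC by (auto simp: bij_betw_def)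
qed

text \<open>A random permutation sends \<open>D\<close> to a uniformly random \<open>k\<close>-set:
  composing with a permutation that takes \<open>C\<close> to \<open>C'\<close> matches the
  permutations with image \<open>C\<close> to those with image \<open>C'\<close>, so all these
  classes have equal size.\<close>

lemma card_permutes_onto:
  assumes "finite R" "C \<in> nsets R k" "D \<in> nsets R k"
  shows "(card R choose k) * card {p. p permutes R \<and> p ` D = C} = fact (card R)"
proof -
  let ?P = "\<lambda>C. {p. p permutes R \<and> p ` D = C}"
  have fin: "finite {p. p permutes R}" using assms by (simp add: finite_permutations)
  have eq: "card (?P C') = card (?P C)" if C': "C' \<in> nsets R k" for C'
  proof -
    obtain q where q: "q permutes R" "q ` C = C'"
      using ex_permutes_image[of R C C'] assms C' by (auto simp: nsets_def)
    have "bij_betw (\<lambda>p. q \<circ> p) (?P C) (?P C')"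
    proof (rule bij_betwI[where g = "\<lambda>p. inv q \<circ> p"])
      have inv: "inv q permutes R" using q permutes_inv by blast
      have ic: "inv q ` C' = C" using q
        by (metis image_inv_f_f permutes_inj)
      show "(\<circ>) q \<in> ?P C \<rightarrow> ?P C'" using q permutes_compose[of _ R q] by (auto simp: image_comp[symmetric])
      show "(\<circ>) (inv q) \<in> ?P C' \<rightarrow> ?P C"
        using inv ic permutes_compose[of _ R "inv q"] by (auto simp: image_comp[symmetric])
      show "inv q \<circ> (q \<circ> p) = p" for p
        using permutes_inv_o(2)[OF q(1)] by (simp flip: comp_assoc)
      show "q \<circ> (inv q \<circ> p) = p" for p
        using permutes_inv_o(1)[OF q(1)] by (simp flip: comp_assoc)
    qed
    then show ?thesis by (simp add: bij_betw_same_card)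
  qed
  have un: "(\<Union>C'\<in>nsets R k. ?P C') = {p. p permutes R}"
  proof -
    have "p ` D \<in> nsets R k" if "p permutes R" for p
      using that assms(3) permutes_image[OF that] card_image[of p D] permutes_inj[OF that]
      by (auto simp: nsets_def inj_on_subset)
    then show ?thesis by auto
  qed
  have "fact (card R) = card (\<Union>C'\<in>nsets R k. ?P C')"
    unfolding un using card_permutations[OF refl assms(1)] by simp
  also have "\<dots> = (\<Sum>C'\<in>nsets R k. card (?P C'))"
    using assms(1) fin
    by (intro card_UN_disjoint) (auto simp: finite_imp_finite_nsets intro: finite_subset[OF _ fin])
  also have "\<dots> = (\<Sum>C'\<in>nsets R k. card (?P C))" using eq by simp
  also have "\<dots> = (card R choose k) * card (?P C)" using assms(1) by simp
  finally show ?thesis by simp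
qed

lemma ex_disjoint_nsets:
  assumes "finite R" "k * m \<le> card R" "k > 0"
  shows "\<exists>\<D>. \<D> \<subseteq> nsets R k \<and> pairwise disjnt \<D> \<and> card \<D> = m"
  using assms
proof (induction m arbitrary: R)
  case 0
  show ?case by (rule exI[of _ "{}"]) auto
next
  case (Suc m)
  have "k \<le> card R" using Suc.prems by simp
  then obtain D where D: "D \<subseteq> R" "card D = k" by (rule obtain_subset_with_card_n)
  have fD: "finite D" using D Suc.prems(1) finite_subset by blast
  have "k * m \<le> card (R - D)" using Suc.prems(2) D fD by (simp add: card_Diff_subset)
  then obtain \<D> where \<D>: "\<D> \<subseteq> nsets (R - D) k" "pairwise disjnt \<D>" "card \<D> = m"
    using Suc.IH[of "R - D"] Suc.prems(1,3) by blast
  have fin: "finite \<D>"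
    using \<D>(1) Suc.prems(1) by (auto intro: finite_subset[OF _ finite_imp_finite_nsets])
  have dis: "C \<inter> D = {} \<and> C \<subseteq> R \<and> finite C \<and> card C = k" if "C \<in> \<D>" for C
    using that \<D>(1) by (auto simp: nsets_def)
  have "D \<noteq> {}" using D \<open>k > 0\<close> by auto
  then have "D \<notin> \<D>" using dis by blast
  show ?case
  proof (intro exI conjI)
    show "insert D \<D> \<subseteq> nsets R k" using dis D fD by (auto simp: nsets_def)
    show "pairwise disjnt (insert D \<D>)"
      using \<D>(2) dis by (auto simp: pairwise_insert disjnt_def)
    show "card (insert D \<D>) = Suc m" using \<D>(3) \<open>D \<notin> \<D>\<close> fin by simp
  qed
qed

text \<open>Double count the pairs of a permutation and a member of a fixed packing \<D> whose image
  lies in \<open>Mis\<close>: every permutation yields at least \<open>d\<close>, and each member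
  hits \<open>Mis\<close> with probability \<open>card Mis / (card R choose k)\<close>.\<close>

lemma averaging_disjoint_sets:
  assumes "finite R" "k * m \<le> card R" "k > 0" "Mis \<subseteq> nsets R k"
    and hit: "\<And>\<C>. \<C> \<subseteq> nsets R k \<Longrightarrow> pairwise disjnt \<C> \<Longrightarrow> card \<C> = m \<Longrightarrow> d \<le> card (\<C> \<inter> Mis)"
  shows "d * (card R choose k) \<le> m * card Mis"
proof -
  obtain \<D> where \<D>: "\<D> \<subseteq> nsets R k" "pairwise disjnt \<D>" "card \<D> = m"
    using ex_disjoint_nsets[OF assms(1-3)] by blast
  have fD: "finite \<D>" by (rule finite_subset[OF \<D>(1) finite_imp_finite_nsets[OF assms(1)]])
  let ?P = "{p. p permutes R}"
  have finP: "finite ?P" using assms by (simp add: finite_permutations)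
  have cP: "card ?P = fact (card R)" using card_permutations[OF refl assms(1)] by simp
  have finM: "finite Mis" by (rule finite_subset[OF assms(4) finite_imp_finite_nsets[OF assms(1)]])
  have img: "p ` D \<in> nsets R k" if "p permutes R" "D \<in> nsets R k" for p D
    using that permutes_image[OF that(1)] card_image[of p D] permutes_inj[OF that(1)]
    by (auto simp: nsets_def inj_on_subset)
  have one: "d \<le> (\<Sum>D\<in>\<D>. if p ` D \<in> Mis then 1 else 0)" if p: "p permutes R" for p
  proof -
    have injp: "inj p" using p permutes_inj by blast
    have inj: "inj_on ((`) p) \<D>" using injp by (meson inj_image_eq_iff inj_onI)
    have sub: "(`) p ` \<D> \<subseteq> nsets R k" using img p \<D> by blast
    have "pairwise disjnt ((`) p ` \<D>)"
    proof (rule pairwise_imageI)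
      fix D D' assume "D \<in> \<D>" "D' \<in> \<D>" "D \<noteq> D'"
      then have "D \<inter> D' = {}" using \<D>(2) by (auto simp: pairwise_def disjnt_def)
      then show "disjnt (p ` D) (p ` D')"
        using image_Int[OF injp, of D D'] by (simp add: disjnt_def)
    qed
    then have "d \<le> card ((`) p ` \<D> \<inter> Mis)"
      using hit sub inj \<D> by (simp add: card_image)
    also have "(`) p ` \<D> \<inter> Mis = (`) p ` {D \<in> \<D>. p ` D \<in> Mis}" by auto
    also have "card \<dots> = card {D \<in> \<D>. p ` D \<in> Mis}"
      by (rule card_image) (use inj in \<open>auto simp: inj_on_def\<close>)
    also have "\<dots> = (\<Sum>D\<in>\<D>. if p ` D \<in> Mis then 1 else 0)"
      using fD by (simp add: sum.If_cases Int_def)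
    finally show ?thesis .
  qed
  have "d * fact (card R) = (\<Sum>p\<in>?P. d)" using cP by simp
  also have "\<dots> \<le> (\<Sum>p\<in>?P. \<Sum>D\<in>\<D>. if p ` D \<in> Mis then 1 else 0)"
    using one by (intro sum_mono) auto
  also have "\<dots> = (\<Sum>D\<in>\<D>. \<Sum>p\<in>?P. if p ` D \<in> Mis then 1 else 0)" by (rule sum.swap)
  also have "\<dots> = (\<Sum>D\<in>\<D>. \<Sum>C\<in>Mis. card {p. p permutes R \<and> p ` D = C})"
  proof (intro sum.cong refl)
    fix D
    have "(\<Sum>p\<in>?P. if p ` D \<in> Mis then 1 else 0) = card {p. p permutes R \<and> p ` D \<in> Mis}"
      using finP by (simp add: sum.If_cases Int_def)
    also have "{p. p permutes R \<and> p ` D \<in> Mis} = (\<Union>C\<in>Mis. {p. p permutes R \<and> p ` D = C})" by auto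
    also have "card \<dots> = (\<Sum>C\<in>Mis. card {p. p permutes R \<and> p ` D = C})"
      using finM by (intro card_UN_disjoint) (auto intro: finite_subset[OF _ finP])
    finally show "(\<Sum>p\<in>?P. if p ` D \<in> Mis then 1 else 0) = (\<Sum>C\<in>Mis. card {p. p permutes R \<and> p ` D = C})" .
  qed
  finally have "d * fact (card R) \<le> (\<Sum>D\<in>\<D>. \<Sum>C\<in>Mis. card {p. p permutes R \<and> p ` D = C})" .
  then have "(card R choose k) * (d * fact (card R))
      \<le> (card R choose k) * (\<Sum>D\<in>\<D>. \<Sum>C\<in>Mis. card {p. p permutes R \<and> p ` D = C})"
    by simp
  also have "\<dots> = (\<Sum>D\<in>\<D>. \<Sum>C\<in>Mis. (card R choose k) * card {p. p permutes R \<and> p ` D = C})"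
    by (simp add: sum_distrib_left)
  also have "\<dots> = (\<Sum>D\<in>\<D>. \<Sum>C\<in>Mis. fact (card R))"
    using \<D>(1) assms by (intro sum.cong refl card_permutes_onto) auto
  also have "\<dots> = m * card Mis * fact (card R)" using \<D> by simp
  finally have "(d * (card R choose k)) * fact (card R) \<le> (m * card Mis) * fact (card R)"
    by (simp add: algebra_simps)
  then show ?thesis by simp
qed

subsection \<open>Shifting\<close>

text \<open>The classical compression of extremal set theory. The clause on \<open>F\<close> is what
  makes the map injective on \<open>F\<close>.\<close>

definition shift_set :: "'a \<Rightarrow> 'a \<Rightarrow> 'a set set \<Rightarrow> 'a set \<Rightarrow> 'a set" where
  "shift_set a b F A =
     (if b \<in> A \<and> a \<notin> A \<and> insert a (A - {b}) \<notin> F then insert a (A - {b}) else A)"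

definition shift :: "'a \<Rightarrow> 'a \<Rightarrow> 'a set set \<Rightarrow> 'a set set" where
  "shift a b F = shift_set a b F ` F"

lemma pairwise_disjnt_insert:
  assumes "pairwise disjnt M" "\<And>B. B \<in> M \<Longrightarrow> disjnt A B"
  shows "pairwise disjnt (insert A M)"
  unfolding pairwise_insert using assms disjnt_sym by blast

lemma card_exchange:
  assumes "finite A" "b \<in> A" "a \<notin> A"
  shows "card (insert a (A - {b})) = card A"
proof -
  have "card (insert a (A - {b})) = Suc (card (A - {b}))"
    using assms by (intro card_insert_disjoint) auto
  then show ?thesis using card.remove[OF assms(1,2)] by simp
qed

text \<open>A moved set lands outside \<open>F\<close> and so cannot collide with an unmoved one;
  two moved sets are recovered by exchanging back.\<close>

lemma shift_set_inj: "inj_on (shift_set a b F) F"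
proof (rule inj_onI)
  fix A B assume "A \<in> F" "B \<in> F" and eq: "shift_set a b F A = shift_set a b F B"
  have inv: "insert b (insert a (X - {b}) - {a}) = X" if "b \<in> X" "a \<notin> X" for X
    using that by blast
  show "A = B"
  proof (cases "shift_set a b F A = A \<or> shift_set a b F B = B")
    case True
    then show ?thesis
      using eq \<open>A \<in> F\<close> \<open>B \<in> F\<close> unfolding shift_set_def by (metis (full_types))
  next
    case False
    then have "b \<in> A" "a \<notin> A" "b \<in> B" "a \<notin> B" "insert a (A - {b}) = insert a (B - {b})"
      using eq unfolding shift_set_def by (auto simp del: insert_Diff_single split: if_splits)
    then show ?thesis using inv[of A] inv[of B] by simp
  qed
qed

lemma card_shift: "card (shift a b F) = card F"
  unfolding shift_def by (rule card_image[OF shift_set_inj])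

lemma shift_set_nsets: "A \<in> nsets V k \<Longrightarrow> a \<in> V \<Longrightarrow> shift_set a b F A \<in> nsets V k"
  using card_exchange[of A b a] unfolding shift_set_def nsets_def by auto

lemma shift_nsets: "F \<subseteq> nsets V k \<Longrightarrow> a \<in> V \<Longrightarrow> shift a b F \<subseteq> nsets V k"
  unfolding shift_def by (auto intro: shift_set_nsets)

lemma shift_new:
  assumes "A \<in> shift a b F" "A \<notin> F"
  shows "a \<in> A" "b \<notin> A" "insert b (A - {a}) \<in> F"
proof -
  obtain B where B: "B \<in> F" "A = shift_set a b F B" using assms(1) unfolding shift_def by auto
  then have "b \<in> B" "a \<notin> B" "A = insert a (B - {b})"
    using assms(2) unfolding shift_set_def by (auto split: if_splits)
  moreover then have "insert b (A - {a}) = B" by blast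
  ultimately show "a \<in> A" "b \<notin> A" "insert b (A - {a}) \<in> F" using B by auto
qed

text \<open>A member with \<open>b\<close> but not \<open>a\<close> cannot be the result of a move,
  so it was kept, and the only reason to keep it is that its exchange is already in
  \<open>F\<close>.\<close>

lemma shift_old:
  assumes "A \<in> shift a b F" "b \<in> A" "a \<notin> A"
  shows "A \<in> F" "insert a (A - {b}) \<in> F"
proof -
  obtain B where B: "B \<in> F" "A = shift_set a b F B" using assms(1) unfolding shift_def by auto
  then have "A = B" using assms unfolding shift_set_def by (auto split: if_splits)
  then show "A \<in> F" "insert a (A - {b}) \<in> F"
    using B assms unfolding shift_set_def by (auto split: if_splits)
qed

text \<open>New members all contain \<open>a\<close>, so a matching has at most one,
  \<open>A\<close>. If no other member contains \<open>b\<close>, undo the exchange in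
  \<open>A\<close>. Otherwise some \<open>B\<close> contains \<open>b\<close>; replacing
  \<open>A\<close>, \<open>B\<close> by \<open>A'\<close>, \<open>B'\<close> swaps \<open>a\<close>
  and \<open>b\<close> between them and stays inside \<open>F\<close>.\<close>

lemma matching_le_shift:
  assumes "finite F" "matching_le F s"
  shows "matching_le (shift a b F) s"
  unfolding matching_le_def
proof (intro allI impI)
  fix M assume M: "M \<subseteq> shift a b F" "pairwise disjnt M"
  have finM: "finite M" using M assms(1) finite_subset unfolding shift_def by blast
  show "card M \<le> s"
  proof (cases "M \<subseteq> F")
    case True
    then show ?thesis using assms M unfolding matching_le_def by blast
  next
    case False
    then obtain A where A: "A \<in> M" "A \<notin> F" by blast
    note An = shift_new[OF subsetD[OF M(1) A(1)] A(2)]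
    define A' where "A' = insert b (A - {a})"
    have other: "B \<in> F \<and> a \<notin> B \<and> disjnt A B" if "B \<in> M" "B \<noteq> A" for B
    proof -
      have d: "disjnt A B" using M(2) A that unfolding pairwise_def by metis
      then have "a \<notin> B" using An by (auto simp: disjnt_def)
      then show ?thesis using d shift_new(1)[of B a b F] that M by blast
    qed
    have cM: "card M = Suc (card (M - {A}))" by (rule card.remove[OF finM A(1)])
    show ?thesis
    proof (cases "\<exists>B\<in>M - {A}. b \<in> B")
      case False
      have "insert A' (M - {A}) \<subseteq> F" using other An unfolding A'_def by blast
      moreover have "pairwise disjnt (insert A' (M - {A}))"
      proof -
        have "disjnt A' B" if "B \<in> M - {A}" for B
          using False other[of B] that unfolding A'_def disjnt_def by blast
        then show ?thesis
          by (intro pairwise_disjnt_insert pairwise_subset[OF M(2)]) auto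
      qed
      moreover have "A' \<notin> M - {A}" using False unfolding A'_def by blast
      then have "card (insert A' (M - {A})) = card M" using cM finM by simp
      ultimately show ?thesis using assms(2) unfolding matching_le_def by metis
    next
      case True
      then obtain B where B: "B \<in> M" "B \<noteq> A" "b \<in> B" by blast
      define B' where "B' = insert a (B - {b})"
      have Bp: "B \<in> F" "a \<notin> B" "disjnt A B" using other B by auto
      have B'F: "B' \<in> F" unfolding B'_def
        using shift_old(2)[of B a b F] B Bp M by blast
      let ?M0 = "M - {A} - {B}"
      have dis: "disjnt A' C \<and> disjnt B' C \<and> a \<notin> C \<and> b \<notin> C \<and> C \<in> F" if C: "C \<in> ?M0" for C
      proof -
        have "disjnt B C" using M(2) B C unfolding pairwise_def by blast
        then show ?thesis using other[of C] C B unfolding A'_def B'_def disjnt_def by blast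
      qed
      have dAB: "disjnt A' B'" using Bp An B unfolding A'_def B'_def disjnt_def by blast
      have "insert A' (insert B' ?M0) \<subseteq> F" using dis An B'F unfolding A'_def by blast
      moreover have "pairwise disjnt (insert A' (insert B' ?M0))"
        using dis dAB by (intro pairwise_disjnt_insert pairwise_subset[OF M(2)]) auto
      moreover have "card (insert A' (insert B' ?M0)) = card M"
      proof -
        have "b \<in> A'" "a \<in> B'" unfolding A'_def B'_def by auto
        then have "B' \<notin> ?M0" "A' \<notin> ?M0" "A' \<noteq> B'"
          using dis dAB by (auto simp: disjnt_def)
        then have "card (insert A' (insert B' ?M0)) = Suc (Suc (card ?M0))"
          using finM by (simp del: Diff_insert)
        also have "\<dots> = card M" using cM finM B
          by (metis card_Suc_Diff1 finite_Diff insertE insert_Diff A(1))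
        finally show ?thesis .
      qed
      ultimately show ?thesis using assms(2) unfolding matching_le_def by metis
    qed
  qed
qed

lemma shift_fixed_mem:
  assumes "shift a b F = F" "A \<in> F" "b \<in> A" "a \<notin> A"
  shows "insert a (A - {b}) \<in> F"
proof (rule ccontr)
  assume "insert a (A - {b}) \<notin> F"
  then have "shift_set a b F A = insert a (A - {b})" using assms by (simp add: shift_set_def)
  then have "insert a (A - {b}) \<in> shift a b F" using assms(2) unfolding shift_def by force
  then show False using assms(1) \<open>insert a (A - {b}) \<notin> F\<close> by simp
qed

text \<open>Minimise the sum of all vertices over all members: a shift to the left that changes the
  family lowers it. The invariant is a parameter because the reduction uses three different
  ones.\<close>

lemma ex_shift_stable:
  fixes F :: "nat set set"
  assumes "Inv F" and fin: "\<And>G. Inv G \<Longrightarrow> finite G \<and> (\<forall>A\<in>G. finite A)"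
  obtains F' where "Inv F'"
    "\<And>a b. a < b \<Longrightarrow> Inv (shift a b F') \<Longrightarrow> shift a b F' = F'"
proof -
  define pot where "pot G = (\<Sum>A\<in>G. \<Sum>A)" for G :: "nat set set"
  obtain F' where F': "Inv F'" "\<And>G. Inv G \<Longrightarrow> pot F' \<le> pot G"
    using ex_has_least_nat[of Inv F pot] assms(1) by blast
  have "shift a b F' = F'" if "a < b" "Inv (shift a b F')" for a b
  proof (rule ccontr)
    assume ne: "shift a b F' \<noteq> F'"
    have f: "finite F'" "\<And>A. A \<in> F' \<Longrightarrow> finite A" using fin F' by blast+
    have val: "\<Sum>(insert a (A - {b})) < \<Sum>A" if "A \<in> F'" "b \<in> A" "a \<notin> A" for A
    proof -
      have "\<Sum>(insert a (A - {b})) = a + \<Sum>(A - {b})" using f that by simp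
      also have "\<dots> < b + \<Sum>(A - {b})" using \<open>a < b\<close> by simp
      also have "\<dots> = \<Sum>A" using f that by (metis sum.remove)
      finally show ?thesis .
    qed
    have le: "\<Sum>(shift_set a b F' A) \<le> \<Sum>A" if "A \<in> F'" for A
      using val[of A] that unfolding shift_set_def by auto
    have "\<exists>A\<in>F'. shift_set a b F' A \<noteq> A"
      using ne unfolding shift_def by (metis image_cong image_ident)
    then have lt: "\<exists>A\<in>F'. \<Sum>(shift_set a b F' A) < \<Sum>A"
      using val unfolding shift_set_def by (auto split: if_splits)
    have "pot (shift a b F') = (\<Sum>A\<in>F'. \<Sum>(shift_set a b F' A))"
      unfolding pot_def shift_def by (simp add: sum.reindex[OF shift_set_inj] o_def)
    also have "\<dots> < pot F'"
      unfolding pot_def using f le lt by (intro sum_strict_mono_ex1) auto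
    finally show False using F'(2)[OF that(2)] by simp
  qed
  then show thesis using that F' by blast
qed

text \<open>The range \<open>m\<close> may be smaller than the ground set: in the base case, at
  first only the vertices up to \<open>N\<close> of \<open>{1..N + 2}\<close> are shifted.\<close>

definition shifted_on :: "nat \<Rightarrow> nat set set \<Rightarrow> bool" where
  "shifted_on m F \<longleftrightarrow>
     (\<forall>A\<in>F. \<forall>a b. 1 \<le> a \<longrightarrow> a < b \<longrightarrow> b \<le> m \<longrightarrow> b \<in> A \<longrightarrow> a \<notin> A \<longrightarrow> insert a (A - {b}) \<in> F)"

lemma shifted_onD:
  "shifted_on m F \<Longrightarrow> A \<in> F \<Longrightarrow> 1 \<le> a \<Longrightarrow> a < b \<Longrightarrow> b \<le> m \<Longrightarrow> b \<in> A \<Longrightarrow> a \<notin> A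
    \<Longrightarrow> insert a (A - {b}) \<in> F"
  unfolding shifted_on_def by blast

text \<open>The hypothesis says that \<open>B\<close> lies componentwise below \<open>A\<close>. Exchanging the least element of
  \<open>A - B\<close> for the least element of the symmetric difference, which lies in \<open>B\<close>, keeps it.\<close>

lemma shifted_on_dominated:
  assumes "shifted_on m F" "A \<in> F" "A - B \<subseteq> {1..m}" "B - A \<subseteq> {1..m}" "finite A" "finite B"
    and "card A = card B"
    and "\<And>y. card (A \<inter> {..y}) \<le> card (B \<inter> {..y})"
  shows "B \<in> F"
  using assms(2-)
proof (induction "card (A - B)" arbitrary: A)
  case 0
  then have "A \<subseteq> B" by simp
  then show ?case using 0 by (metis card_subset_eq)
next
  case (Suc d)
  have ne: "A - B \<noteq> {}" using Suc.hyps(2) by (metis card.empty nat.distinct(1))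
  define b where "b = Min (A - B)"
  have b: "b \<in> A" "b \<notin> B" and bmin: "\<And>x. x \<in> A - B \<Longrightarrow> b \<le> x"
    using ne Suc.prems Min_in[of "A - B"] Min_le[of "A - B"] unfolding b_def by auto
  have "\<exists>c\<in>B - A. c < b"
  proof (rule ccontr)
    assume no: "\<not> ?thesis"
    have "B \<inter> {..b} \<subset> A \<inter> {..b}" using b no by (auto simp: not_less) (metis DiffI le_neq_implies_less no)
    then have "card (B \<inter> {..b}) < card (A \<inter> {..b})" by (intro psubset_card_mono) auto
    then show False using Suc.prems(7)[of b] by simp
  qed
  then obtain c where c: "c \<in> B" "c \<notin> A" "c < b" by blast
  define A' where "A' = insert c (A - {b})"
  have A'F: "A' \<in> F" unfolding A'_def
    using assms(1) Suc.prems b c by (intro shifted_onD[where m = m]) auto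
  have diff: "A' - B = (A - B) - {b}" unfolding A'_def using b c by auto
  have d: "d = card (A' - B)" unfolding diff using Suc.hyps(2) b by simp
  have "card (A' \<inter> {..y}) \<le> card (B \<inter> {..y})" for y
  proof (cases "y < b")
    case True
    have "A' \<inter> {..y} \<subseteq> B \<inter> {..y}" using bmin c True unfolding A'_def by force
    then show ?thesis using Suc.prems by (intro card_mono) auto
  next
    case False
    have "A' \<inter> {..y} = insert c ((A \<inter> {..y}) - {b})" using False c unfolding A'_def by auto
    then have "card (A' \<inter> {..y}) = Suc (card ((A \<inter> {..y}) - {b}))" using c by simp
    also have "\<dots> = card (A \<inter> {..y})" using b False by (intro card_Suc_Diff1) auto
    finally show ?thesis using Suc.prems(7)[of y] by simp
  qed
  moreover have "card A' = card A" unfolding A'_def using Suc.prems(4) b c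
    by (intro card_exchange) auto
  ultimately show ?case
    using Suc.hyps(1)[OF d A'F] Suc.prems b c unfolding A'_def by auto
qed

subsection \<open>Cross-intersecting families\<close>

lemma card_nsets_superset:
  assumes "finite U" "T \<subseteq> U" "card T \<le> r"
  shows "card {A \<in> nsets U r. T \<subseteq> A} = (card U - card T) choose (r - card T)"
proof -
  have fT: "finite T" using assms finite_subset by blast
  have bij: "bij_betw (\<lambda>A. A \<union> T) (nsets (U - T) (r - card T)) {A \<in> nsets U r. T \<subseteq> A}"
  proof (rule bij_betwI[where g = "\<lambda>A. A - T"])
    show "(\<lambda>A. A \<union> T) \<in> nsets (U - T) (r - card T) \<rightarrow> {A \<in> nsets U r. T \<subseteq> A}"
    proof
      fix A assume A: "A \<in> nsets (U - T) (r - card T)"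
      then have "card (A \<union> T) = card A + card T"
        using fT by (intro card_Un_disjoint) (auto simp: nsets_def)
      then show "A \<union> T \<in> {A \<in> nsets U r. T \<subseteq> A}" using A assms fT by (auto simp: nsets_def)
    qed
    show "(\<lambda>A. A - T) \<in> {A \<in> nsets U r. T \<subseteq> A} \<rightarrow> nsets (U - T) (r - card T)"
      using fT by (auto simp: nsets_def card_Diff_subset)
  qed (auto simp: nsets_def)
  have "card {A \<in> nsets U r. T \<subseteq> A} = card (nsets (U - T) (r - card T))"
    by (rule bij_betw_same_card[OF bij, symmetric])
  also have "\<dots> = (card U - card T) choose (r - card T)"
    using assms fT by (simp add:  card_Diff_subset)
  finally show ?thesis .
qed

lemma card_nsets_meeting:
  assumes "finite U" "A \<subseteq> U"
  shows "card {B \<in> nsets U r. B \<inter> A \<noteq> {}} = (card U choose r) - ((card U - card A) choose r)"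
proof -
  have fA: "finite A" using assms finite_subset by blast
  have "{B \<in> nsets U r. B \<inter> A \<noteq> {}} = nsets U r - nsets (U - A) r" by (auto simp: nsets_def)
  moreover have "nsets (U - A) r \<subseteq> nsets U r" by (rule nsets_mono) auto
  ultimately show ?thesis
    using assms fA by (simp add: card_Diff_subset finite_imp_finite_nsets)
qed

text \<open>Bonferroni for the \<open>r\<close>-sets meeting a fixed \<open>i\<close>-set, written
  without subtraction. By Pascal's rule the point after the first \<open>i\<close> adds
  \<open>(N - 1 - i) choose (r - 1)\<close> sets.\<close>

lemma binomial_meeting_lower_bound:
  assumes "r \<ge> 2" "i < N"
  shows "i * ((N - 1) choose (r - 1)) + ((N - i) choose r)
    \<le> (N choose r) + i * i * ((N - 2) choose (r - 2))"
  using assms(2)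
proof (induction i)
  case 0
  then show ?case by simp
next
  case (Suc i)
  let ?S = "(N - 1) choose (r - 1)" and ?Q = "(N - 2) choose (r - 2)"
  \<comment> \<open>Each of the \<open>j\<close> deleted points loses at most \<open>?Q\<close> of
    the \<open>(r - 1)\<close>-sets.\<close>
  have step: "?S \<le> ((N - 1 - j) choose (r - 1)) + j * ?Q" if "j < N" for j
    using that
  proof (induction j)
    case (Suc j)
    have "(N - 1 - j) choose (r - 1) = ((N - 1 - Suc j) choose (r - 1)) + ((N - 1 - Suc j) choose (r - 2))"
      using Suc.prems assms(1) choose_reduce_nat[of "N - 1 - j" "r - 1"]
      by (simp add: numeral_2_eq_2)
    moreover have "(N - 1 - Suc j) choose (r - 2) \<le> ?Q" by (intro binomial_right_mono) auto
    ultimately show ?case using Suc.IH Suc.prems by simp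
  qed simp
  have "(N - i) choose r = ((N - Suc i) choose r) + ((N - 1 - i) choose (r - 1))"
    using Suc.prems assms(1) choose_reduce_nat[of "N - i" r] by simp
  moreover have "?S \<le> ((N - 1 - i) choose (r - 1)) + i * ?Q" using step Suc.prems by simp
  moreover have "i * ?S + ((N - i) choose r) \<le> (N choose r) + i * i * ?Q"
    using Suc.IH Suc.prems by simp
  ultimately have "Suc i * ?S + ((N - Suc i) choose r) \<le> (N choose r) + (i * i + i) * ?Q"
    by (simp add: algebra_simps)
  also have "\<dots> \<le> (N choose r) + Suc i * Suc i * ?Q" by (simp add: algebra_simps)
  finally show ?case .
qed

text \<open>Fix \<open>A\<close> in \<open>H'\<close>. A member of \<open>H\<close> either contains
  a point of the kernel \<open>\<Inter>H'\<close>, or meets \<open>A\<close> in some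
  \<open>a\<close> outside the kernel; then a member of \<open>H'\<close> that omits
  \<open>a\<close> must be met in a second point \<open>b\<close>. There are at most
  \<open>r * r\<close> such pairs.\<close>

lemma cross_intersecting_card_le:
  assumes "finite U" "H \<subseteq> nsets U r" "H' \<subseteq> nsets U r" "H' \<noteq> {}" "r \<ge> 2"
    and cross: "\<And>A B. A \<in> H \<Longrightarrow> B \<in> H' \<Longrightarrow> A \<inter> B \<noteq> {}"
  shows "card H \<le> card (\<Inter>H') * ((card U - 1) choose (r - 1)) + r * r * ((card U - 2) choose (r - 2))"
proof -
  obtain A where A: "A \<in> H'" using assms by blast
  have AU: "A \<subseteq> U" "finite A" "card A = r" using A assms by (auto simp: nsets_def)
  have "\<forall>a\<in>A - \<Inter>H'. \<exists>B\<in>H'. a \<notin> B" by blast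
  then obtain f where f: "\<And>a. a \<in> A - \<Inter>H' \<Longrightarrow> f a \<in> H' \<and> a \<notin> f a" by metis
  have fU: "f a \<subseteq> U" "finite (f a)" "card (f a) = r" if "a \<in> A - \<Inter>H'" for a
    using f[OF that] assms by (auto simp: nsets_def)
  have DA: "\<Inter>H' \<subseteq> A" using A by blast
  have fD: "finite (\<Inter>H')" using DA AU finite_subset by blast
  let ?X = "\<Union>d\<in>\<Inter>H'. {B \<in> nsets U r. {d} \<subseteq> B}"
  let ?Y = "\<Union>a\<in>A - \<Inter>H'. \<Union>b\<in>f a. {B \<in> nsets U r. {a, b} \<subseteq> B}"
  have sub: "H \<subseteq> ?X \<union> ?Y"
  proof
    fix B assume B: "B \<in> H"
    show "B \<in> ?X \<union> ?Y"
    proof (cases "B \<inter> \<Inter>H' = {}")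
      case False
      then show ?thesis using B assms by auto
    next
      case True
      obtain a where a: "a \<in> B" "a \<in> A" using cross[OF B A] by blast
      then have aD: "a \<in> A - \<Inter>H'" using True by blast
      obtain b where "b \<in> B" "b \<in> f a" using cross[OF B] f[OF aD] by blast
      then show ?thesis using a aD B assms by blast
    qed
  qed
  have fin: "finite (?X \<union> ?Y)"
    by (rule finite_subset[of _ "nsets U r"]) (use assms in \<open>auto simp: finite_imp_finite_nsets\<close>)
  have "card ?X \<le> (\<Sum>d\<in>\<Inter>H'. card {B \<in> nsets U r. {d} \<subseteq> B})"
    using fD by (rule card_UN_le)
  also have "\<dots> \<le> (\<Sum>d\<in>\<Inter>H'. (card U - 1) choose (r - 1))"
  proof (rule sum_mono)
    fix d assume "d \<in> \<Inter>H'"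
    then have "d \<in> U" using DA AU by blast
    then show "card {B \<in> nsets U r. {d} \<subseteq> B} \<le> (card U - 1) choose (r - 1)"
      using card_nsets_superset[OF assms(1), of "{d}" r] assms by simp
  qed
  finally have X: "card ?X \<le> card (\<Inter>H') * ((card U - 1) choose (r - 1))" by simp
  have inner: "card (\<Union>b\<in>f a. {B \<in> nsets U r. {a, b} \<subseteq> B}) \<le> r * ((card U - 2) choose (r - 2))"
    if a: "a \<in> A - \<Inter>H'" for a
  proof -
    have "card (\<Union>b\<in>f a. {B \<in> nsets U r. {a, b} \<subseteq> B})
        \<le> (\<Sum>b\<in>f a. card {B \<in> nsets U r. {a, b} \<subseteq> B})"
      using fU[OF a] by (intro card_UN_le) auto
    also have "\<dots> \<le> (\<Sum>b\<in>f a. (card U - 2) choose (r - 2))"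
    proof (rule sum_mono)
      fix b assume b: "b \<in> f a"
      then have "a \<noteq> b" "{a, b} \<subseteq> U" using f[OF a] fU[OF a] a AU by auto
      then show "card {B \<in> nsets U r. {a, b} \<subseteq> B} \<le> (card U - 2) choose (r - 2)"
        using card_nsets_superset[OF assms(1), of "{a, b}" r] assms(5) by (simp add: numeral_2_eq_2)
    qed
    finally show ?thesis using fU[OF a] by simp
  qed
  have "card ?Y \<le> (\<Sum>a\<in>A - \<Inter>H'. card (\<Union>b\<in>f a. {B \<in> nsets U r. {a, b} \<subseteq> B}))"
    using AU by (intro card_UN_le) auto
  also have "\<dots> \<le> (\<Sum>a\<in>A - \<Inter>H'. r * ((card U - 2) choose (r - 2)))"
    using inner by (rule sum_mono)
  also have "\<dots> = card (A - \<Inter>H') * (r * ((card U - 2) choose (r - 2)))" by simp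
  also have "\<dots> \<le> r * (r * ((card U - 2) choose (r - 2)))"
    using AU card_mono[of A "A - \<Inter>H'"] by (intro mult_right_mono) auto
  finally have Y: "card ?Y \<le> r * r * ((card U - 2) choose (r - 2))" by (simp add: mult.assoc)
  have "card H \<le> card (?X \<union> ?Y)" by (rule card_mono[OF fin sub])
  also have "\<dots> \<le> card ?X + card ?Y" by (rule card_Un_le)
  finally show ?thesis using X Y by linarith
qed

lemma card_le_of_common_element:
  assumes "finite U" "H \<subseteq> nsets U r" "d \<in> U" "r \<ge> 2" "\<And>A. A \<in> H \<Longrightarrow> d \<in> A"
  shows "card H \<le> (card U - 1) choose (r - 1)"
proof -
  have "card H \<le> card {A \<in> nsets U r. {d} \<subseteq> A}"
    using assms by (intro card_mono) (auto simp: finite_imp_finite_nsets)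
  then show ?thesis using card_nsets_superset[OF assms(1), of "{d}" r] assms by simp
qed

lemma card_le_of_common_pair:
  assumes "finite U" "H \<subseteq> nsets U r" "{c, d} \<subseteq> U" "c \<noteq> d" "r \<ge> 2" "\<And>A. A \<in> H \<Longrightarrow> {c, d} \<subseteq> A"
  shows "card H \<le> (card U - 2) choose (r - 2)"
proof -
  have "card H \<le> card {A \<in> nsets U r. {c, d} \<subseteq> A}"
    using assms by (intro card_mono) (auto simp: finite_imp_finite_nsets)
  then show ?thesis using card_nsets_superset[OF assms(1,3), of r] assms(4,5) by (simp add: numeral_2_eq_2)
qed

text \<open>To be used with the links of \<open>N + 1\<close> and \<open>N + 2\<close> and
  \<open>t = n - N\<close>. The two values come from a single set in \<open>H'\<close> with all sets
  meeting it, and from two equal stars. The cases compare the kernels of \<open>H\<close> and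
  \<open>H'\<close>; sets through two prescribed points number only \<open>Q\<close>, which
  \<open>big\<close> makes small against a star \<open>S\<close>.\<close>

lemma cross_intersecting_weighted:
  assumes "finite U" "H \<subseteq> nsets U r" "H' \<subseteq> nsets U r" "H' \<noteq> {}" "r \<ge> 2" "t \<ge> 2"
    and cross: "\<And>A B. A \<in> H \<Longrightarrow> B \<in> H' \<Longrightarrow> A \<inter> B \<noteq> {}"
    and le: "card H' \<le> card H"
    and big: "4 * (r * r) * ((card U - 2) choose (r - 2)) \<le> (card U - 1) choose (r - 1)"
    and rU: "r < card U"
  shows "card H + (t - 1) * card H' \<le>
    max ((card U choose r) - ((card U - r) choose r) + (t - 1)) (t * ((card U - 1) choose (r - 1)))"
proof -
  define S where "S = (card U - 1) choose (r - 1)"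
  define Q where "Q = (card U - 2) choose (r - 2)"
  define E where "E = (card U choose r) - ((card U - r) choose r)"
  define h where "h = card H"
  define h' where "h' = card H'"
  have fH: "finite H" "finite H'" using assms finite_subset finite_imp_finite_nsets by metis+
  have hh: "h' \<le> h" "h' \<ge> 1" using le fH assms(4) by (auto simp: h_def h'_def Suc_le_eq card_gt_0_iff)
  then have Hne: "H \<noteq> {}" unfolding h_def by auto
  have big': "4 * (r * r) * Q \<le> S" using big unfolding S_def Q_def .
  have b1: "h \<le> card (\<Inter>H') * S + r * r * Q"
    unfolding h_def S_def Q_def
    by (rule cross_intersecting_card_le[OF assms(1-5) cross])
  have b2: "h' \<le> card (\<Inter>H) * S + r * r * Q"
    unfolding h'_def S_def Q_def
    using cross by (intro cross_intersecting_card_le[OF assms(1) assms(3) assms(2) Hne assms(5)]) blast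
  have IU: "\<Inter>H' \<subseteq> U" "\<Inter>H \<subseteq> U" using assms(2-4) Hne unfolding nsets_def by blast+
  have tt: "t = Suc (t - 1)" using assms(6) by simp
  have rr: "r * r \<ge> 1" using assms(5) by (metis One_nat_def Suc_leI mult_pos_pos order_less_le_trans pos2)
  have Q_le: "Q \<le> r * r * Q" using rr by (metis mult_le_mono1 nat_mult_1)
  \<comment> \<open>As \<open>h' \<le> h\<close>, the claim is settled whenever \<open>H\<close> has
    order \<open>Q\<close>.\<close>
  have small: "h + (t - 1) * h' \<le> t * S" if "h \<le> 2 * (r * r) * Q"
  proof -
    have "h \<le> S" using that big' by linarith
    then have "h + (t - 1) * h' \<le> S + (t - 1) * S" using hh by (intro add_mono mult_left_mono) auto
    also have "\<dots> = t * S" by (subst (2) tt) simp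
    finally show ?thesis .
  qed
  consider (one) "h' = 1" | (D2) "h' \<ge> 2" "card (\<Inter>H') \<ge> 2" | (D2') "card (\<Inter>H) \<ge> 2"
    | (D1) "card (\<Inter>H') = 1" "card (\<Inter>H) = 1" | (D0) "card (\<Inter>H') = 0"
    | (D0') "card (\<Inter>H') = 1" "card (\<Inter>H) = 0"
    using hh by linarith
  then have "h + (t - 1) * h' \<le> max (E + (t - 1)) (t * S)"
  proof cases
    case one
    then obtain A where A: "H' = {A}" unfolding h'_def by (auto simp: card_1_singleton_iff)
    have AU: "A \<subseteq> U" "card A = r" using A assms(3) by (auto simp: nsets_def)
    have "h \<le> card {B \<in> nsets U r. B \<inter> A \<noteq> {}}"
      unfolding h_def using cross A assms(1,2) by (intro card_mono) (auto simp: finite_imp_finite_nsets)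
    then have "h \<le> E" using card_nsets_meeting[OF assms(1) AU(1), of r] AU unfolding E_def by simp
    then show ?thesis using one by simp
  next
    \<comment> \<open>Two common points give \<open>h' \<le> Q\<close>, and two distinct members of
      \<open>H'\<close> keep the kernel below \<open>r\<close> points. So \<open>h\<close> is at
      most about \<open>r - 1\<close> stars: for \<open>t \<ge> r\<close> this is beaten by
      \<open>t\<close> stars, for \<open>t < r\<close> by \<open>E\<close>, which is almost
      \<open>r\<close> stars.\<close>
    case D2
    have "h' \<le> Q"
    proof -
      obtain c d where cd: "c \<in> \<Inter>H'" "d \<in> \<Inter>H'" "c \<noteq> d"
        using D2(2) card_le_Suc0_iff_eq[of "\<Inter>H'"] IU assms(1) finite_subset by fastforce
      show ?thesis unfolding h'_def Q_def
        by (rule card_le_of_common_pair[OF assms(1,3) _ cd(3) assms(5)]) (use cd IU in auto)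
    qed
    have "card (\<Inter>H') \<le> r - 1"
    proof -
      obtain A B where AB: "A \<in> H'" "B \<in> H'" "A \<noteq> B"
        using D2(1) fH(2) card_le_Suc0_iff_eq[of H'] unfolding h'_def by fastforce
      have fin: "finite A" "finite B" "card A = r" "card B = r" using AB assms(3) by (auto simp: nsets_def)
      have "A \<inter> B \<subset> A" using AB fin by (metis Int_lower1 card_subset_eq inf.absorb_iff1 psubsetI)
      then have "card (A \<inter> B) < r" using fin psubset_card_mono by metis
      moreover have "card (\<Inter>H') \<le> card (A \<inter> B)" using AB fin by (intro card_mono) auto
      ultimately show ?thesis by simp
    qed
    then have "card (\<Inter>H') * S \<le> (r - 1) * S" by (intro mult_right_mono) auto
    with b1 have h1: "h \<le> (r - 1) * S + r * r * Q" by linarith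
    have "(t - 1) * h' \<le> (t - 1) * Q" using \<open>h' \<le> Q\<close> by simp
    with h1 have tot: "h + (t - 1) * h' \<le> (r - 1) * S + r * r * Q + (t - 1) * Q" by linarith
    show ?thesis
    proof (cases "t \<ge> r")
      case True
      \<comment> \<open>The surplus of \<open>u\<close> stars absorbs all error terms because
        \<open>t - 1 \<le> r * u\<close>.\<close>
      define u where "u = t - r + 1"
      have u: "t = (r - 1) + u" "u \<ge> 1" using True assms(5) unfolding u_def by auto
      have "r * r * Q + (t - 1) * Q \<le> u * (4 * (r * r) * Q)"
      proof -
        have "t - 1 \<le> r * u" 
        proof -
          have "r - 1 \<le> (r - 1) * u" using u(2) by simp
          moreover have "r * u = (r - 1) * u + u" using assms(5) by (cases r) auto
          ultimately show ?thesis using u by linarith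
        qed
        also have "\<dots> \<le> r * r * u" using assms(5) by simp
        finally have "(t - 1) * Q \<le> r * r * u * Q" by (rule mult_right_mono) simp
        moreover have "r * r * Q \<le> r * r * u * Q" using u(2) by simp
        moreover have "u * (4 * (r * r) * Q) = 4 * (r * r * u * Q)" by (simp add: algebra_simps)
        ultimately show ?thesis by linarith
      qed
      also have "\<dots> \<le> u * S" using big' by (rule mult_left_mono) simp
      finally have "h + (t - 1) * h' \<le> (r - 1) * S + u * S" using tot by linarith
      also have "\<dots> = t * S" using u(1) by (simp add: algebra_simps)
      finally show ?thesis by simp
    next
      case False
      have "r * S + ((card U - r) choose r) \<le> (card U choose r) + r * r * Q"
        unfolding S_def Q_def by (rule binomial_meeting_lower_bound[OF assms(5) rU])
      then have e: "r * S \<le> E + r * r * Q"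
        unfolding E_def by linarith
      have "(t - 1) * Q \<le> r * r * Q"
      proof -
        have "t - 1 \<le> r * r" using False assms(5) by (meson diff_le_self dual_order.trans le_cases le_square)
        then show ?thesis by (rule mult_right_mono) simp
      qed
      moreover have "r * S = (r - 1) * S + S" using assms(5) by (cases r) auto
      ultimately have "h + (t - 1) * h' \<le> E" using tot e big' by linarith
      then show ?thesis by simp
    qed
  next
    case D2'
    obtain c d where cd: "c \<in> \<Inter>H" "d \<in> \<Inter>H" "c \<noteq> d"
      using D2' card_le_Suc0_iff_eq[of "\<Inter>H"] IU assms(1) finite_subset by fastforce
    have "h \<le> Q" unfolding h_def Q_def
      by (rule card_le_of_common_pair[OF assms(1,2) _ cd(3) assms(5)]) (use cd IU in auto)
    then show ?thesis using small Q_le by linarith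
  next
    case D1
    obtain d d' where d: "\<Inter>H' = {d}" "\<Inter>H = {d'}" using D1 by (auto simp: card_1_singleton_iff)
    have "h \<le> S" unfolding h_def S_def
      by (rule card_le_of_common_element[OF assms(1,2) _ assms(5), of d']) (use d IU in blast)+
    then have "h + (t - 1) * h' \<le> S + (t - 1) * S" using hh by (intro add_mono mult_left_mono) auto
    also have "\<dots> = t * S" by (subst (2) tt) simp
    finally show ?thesis by simp
  next
    case D0
    then have "h \<le> 2 * (r * r) * Q" using b1 by simp
    then show ?thesis using small by simp
  next
    \<comment> \<open>Now \<open>h'\<close> has order \<open>Q\<close>, and as
      \<open>t \<ge> 2\<close> the error in \<open>h\<close> can be charged to the
      \<open>t - 1\<close> copies of \<open>H'\<close>.\<close>
    case D0'
    have "h \<le> S + r * r * Q" "h' \<le> r * r * Q" using b1 b2 D0' by simp_all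
    then have "h + (t - 1) * h' \<le> S + r * r * Q + (t - 1) * (r * r * Q)"
      by (intro add_mono mult_left_mono) auto
    also have "\<dots> \<le> S + (t - 1) * (2 * (r * r * Q))"
    proof -
      have "1 * (r * r * Q) \<le> (t - 1) * (r * r * Q)" using assms(6) by (intro mult_right_mono) auto
      moreover have "(t - 1) * (2 * (r * r * Q)) = 2 * ((t - 1) * (r * r * Q))" by simp
      ultimately show ?thesis by linarith
    qed
    also have "\<dots> \<le> S + (t - 1) * S" using big' by (intro add_left_mono mult_left_mono) linarith+
    also have "\<dots> = t * S" by (subst (2) tt) simp
    finally show ?thesis by simp
  qed
  then show ?thesis unfolding h_def h'_def E_def S_def .
qed

subsection \<open>Shifted families\<close>

lemma matching_le_Un:
  assumes "matching_le F s" "\<C> \<union> \<G> \<subseteq> F" "pairwise disjnt \<C>" "pairwise disjnt \<G>"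
    and "\<And>C G. C \<in> \<C> \<Longrightarrow> G \<in> \<G> \<Longrightarrow> disjnt C G" "{} \<notin> F" "finite F"
  shows "card \<C> + card \<G> \<le> s"
proof -
  have fin: "finite \<C>" "finite \<G>" using assms(2,7) finite_subset by blast+
  have "\<C> \<inter> \<G> = {}"
  proof (rule ccontr)
    assume "\<C> \<inter> \<G> \<noteq> {}"
    then obtain C where "C \<in> \<C>" "C \<in> \<G>" by blast
    then have "C = {}" using assms(5)[of C C] by (simp add: disjnt_def)
    then show False using \<open>C \<in> \<C>\<close> assms(2,6) by blast
  qed
  moreover have "pairwise disjnt (\<C> \<union> \<G>)"
    unfolding pairwise_def
  proof (intro ballI impI)
    fix A B assume "A \<in> \<C> \<union> \<G>" "B \<in> \<C> \<union> \<G>" "A \<noteq> B"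
    then show "disjnt A B"
      using assms(3,4) assms(5)[of A B] assms(5)[of B A] unfolding pairwise_def
      by (metis Un_iff disjnt_sym)
  qed
  ultimately show ?thesis
    using assms(1,2) fin unfolding matching_le_def by (metis card_Un_disjoint)
qed

text \<open>With exactly \<open>k * m\<close> vertices the factor \<open>m\<close> in the averaging
  bound cancels, leaving at least \<open>(k * m - 1) choose (k - 1)\<close> missing sets for
  \<open>d = 1\<close>.\<close>

lemma k_times_choose: "k > 0 \<Longrightarrow> m > 0 \<Longrightarrow> (k * m) choose k = m * ((k * m - 1) choose (k - 1))"
proof -
  assume "k > 0" "m > 0"
  then have "k * ((k * m) choose k) = (k * m) * ((k * m - 1) choose (k - 1))"
    by (metis mult_is_0 neq0_conv times_binomial_minus1_eq)
  then show ?thesis using \<open>k > 0\<close> by simp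
qed

lemma power_le_binomial: "0 < k \<Longrightarrow> k \<le> n \<Longrightarrow> n ^ k \<le> k ^ k * (n choose k)"
proof -
  assume a: "0 < k" "k \<le> n"
  have "(real n / real k) ^ k \<le> real (n choose k)"
    by (rule binomial_ge_n_over_k_pow_k[OF a(2)])
  then have "real n ^ k \<le> real k ^ k * real (n choose k)"
    using a(1) by (simp add: power_divide divide_le_eq mult.commute)
  then show ?thesis by (metis of_nat_le_iff of_nat_mult of_nat_power)
qed

text \<open>Non-triviality enters through \<open>last_covered\<close>: in a shifted family any
  member containing \<open>n\<close> can be shifted down to this one.\<close>

locale shifted_family =
  fixes k s n :: nat and F :: "nat set set"
  assumes k3: "k \<ge> 3" and s3: "s \<ge> 3" and n_ge: "n \<ge> k * s + k"
    and F_nsets: "F \<subseteq> nsets {1..n} k"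
    and shifted: "shifted_on n F"
    and match: "matching_le F s"
    and last_covered: "insert n {1..k - 1} \<in> F"
begin

text \<open>\<open>{1..N}\<close> is two vertices short of holding \<open>s + 1\<close> disjoint
  \<open>k\<close>-sets.\<close>

definition N where "N = k * s + k - 2"
definition Mis where "Mis = nsets {1..N} k - F"
definition Out where "Out = F - nsets {1..N} k"

lemma N_bounds: "N + 2 = k * (s + 1)" "N + 2 \<le> n" "k + 2 \<le> N"
proof -
  have "k * 3 \<le> k * s" using s3 by (rule mult_le_mono2)
  then have "k * s \<ge> 9" using k3 by linarith
  then show "N + 2 = k * (s + 1)" "N + 2 \<le> n" "k + 2 \<le> N"
    using k3 n_ge unfolding N_def by simp_all
qed

lemma F_mem: "A \<in> F \<Longrightarrow> A \<subseteq> {1..n} \<and> finite A \<and> card A = k"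
  using F_nsets by (auto simp: nsets_def)

lemma finite_F: "finite F"
  by (rule finite_subset[OF F_nsets]) (simp add: finite_imp_finite_nsets)

lemma empty_notin_F: "{} \<notin> F"
  using F_mem[of "{}"] k3 by auto

lemma card_F: "card F + card Mis = (N choose k) + card Out"
proof -
  let ?G = "nsets {1..N} k"
  have fin: "finite ?G" by (simp add: finite_imp_finite_nsets)
  have "card F = card (F \<inter> ?G) + card Out"
    unfolding Out_def using card_Diff_subset_Int[of F ?G] finite_F
    by (metis Int_Diff_Un card_Un_disjoint finite_Diff finite_Int Int_Diff_disjoint)
  moreover have "card ?G = card (F \<inter> ?G) + card Mis"
    unfolding Mis_def using fin
    by (metis Int_Diff_Un Int_Diff_disjoint card_Un_disjoint finite_Diff finite_Int inf_commute)
  ultimately show ?thesis by simp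
qed

text \<open>Of \<open>m\<close> disjoint \<open>k\<close>-sets in \<open>R\<close> at most
  \<open>m - d\<close> belong to \<open>F\<close>, so at least \<open>d\<close> are missing, and
  averaging applies.\<close>

lemma card_Mis_lower:
  assumes "R \<subseteq> {1..N}" "k * m \<le> card R"
    and few: "\<And>\<C>. \<C> \<subseteq> F \<inter> nsets R k \<Longrightarrow> pairwise disjnt \<C> \<Longrightarrow> card \<C> + d \<le> m"
  shows "d * (card R choose k) \<le> m * card Mis"
proof -
  have fR: "finite R" using assms(1) finite_subset by blast
  have sub: "nsets R k \<subseteq> nsets {1..N} k" by (rule nsets_mono[OF assms(1)])
  have "d * (card R choose k) \<le> m * card (Mis \<inter> nsets R k)"
  proof (rule averaging_disjoint_sets[OF fR assms(2)])
    fix \<C> assume C: "\<C> \<subseteq> nsets R k" "pairwise disjnt \<C>" "card \<C> = m"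
    have fin: "finite \<C>" by (rule finite_subset[OF C(1) finite_imp_finite_nsets[OF fR]])
    have "\<C> \<inter> (Mis \<inter> nsets R k) = \<C> - F" using C(1) sub unfolding Mis_def by blast
    moreover have "card (\<C> \<inter> F) + d \<le> m"
      by (rule few) (use C pairwise_subset in blast)+
    moreover have "card \<C> = card (\<C> \<inter> F) + card (\<C> - F)"
      using fin by (metis Int_Diff_Un Int_Diff_disjoint card_Un_disjoint finite_Diff finite_Int)
    ultimately show "d \<le> card (\<C> \<inter> (Mis \<inter> nsets R k))" using C(3) by simp
  qed (use k3 in auto)
  also have "\<dots> \<le> m * card Mis"
    unfolding Mis_def by (intro mult_le_mono2 card_mono) (auto simp: finite_imp_finite_nsets)
  finally show ?thesis .
qed

lemma dominated:
  assumes "A \<in> F" "B \<subseteq> {1..n}" "card B = k" "\<And>y. card (A \<inter> {..y}) \<le> card (B \<inter> {..y})"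
  shows "B \<in> F"
  using F_mem[OF assms(1)] assms finite_subset[OF assms(2)]
  by (intro shifted_on_dominated[OF shifted assms(1)]) auto

lemma replace_last:
  assumes "insert x B \<in> F" "x \<notin> B" "1 \<le> y" "y \<le> x" "y \<notin> B"
  shows "insert y B \<in> F"
proof (cases "y = x")
  case False
  have "x \<le> n" using F_mem[OF assms(1)] by auto
  have "insert y (insert x B - {x}) \<in> F"
    by (rule shifted_onD[OF shifted assms(1)]) (use assms False \<open>x \<le> n\<close> in auto)
  then show ?thesis using assms(2) by simp
qed (use assms in simp)

lemma initial_plus: "k \<le> x \<Longrightarrow> x \<le> n \<Longrightarrow> insert x {1..k - 1} \<in> F"
  by (rule replace_last[OF last_covered]) (use k3 N_bounds in auto)

section \<open>Few missing sets: links of the outer vertices\<close>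

definition link where "link x = {B \<in> nsets {1..N} (k - 1). insert x B \<in> F}"

text \<open>Two configurations would force too many missing sets: a member with two vertices beyond
  \<open>N\<close>, and disjoint members of the links of \<open>N + 1\<close> and
  \<open>N + 2\<close>. They leave \<open>k * s\<close> and \<open>k * (s - 1)\<close> vertices, and
  the threshold in \<open>few\<close> is the smaller of the two resulting counts.\<close>

lemma Out_few_missing:
  assumes few: "card Mis < (k * (s - 1) - 1) choose (k - 1)"
    and big: "4 * ((k - 1) * (k - 1)) * ((N - 2) choose (k - 1 - 2)) \<le> (N - 1) choose (k - 1 - 1)"
  shows "card Out \<le> max ((N choose (k - 1)) - ((N - (k - 1)) choose (k - 1)) + (n - N - 1))
      ((n - N) * ((N - 1) choose (k - 2)))"
proof -
  have one: "card (A - {1..N}) = 1" if A: "A \<in> Out" for A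
  proof (rule ccontr)
    assume ne: "card (A - {1..N}) \<noteq> 1"
    have AF: "A \<in> F" and An: "A \<subseteq> {1..n}" "finite A" "card A = k"
      using A F_mem unfolding Out_def by auto
    have "A - {1..N} \<noteq> {}" using A An unfolding Out_def by (auto simp: nsets_def)
    then have "card (A - {1..N}) \<noteq> 0" using An by simp
    then have two: "card (A - {1..N}) \<ge> 2" using ne by simp
    have cAN: "card (A \<inter> {1..N}) \<le> k - 2"
      using two An card_Diff_subset_Int[of A "{1..N}"] card_mono[of A "A \<inter> {1..N}"] by simp
    \<comment> \<open>The lowest \<open>k\<close>-set with two vertices beyond \<open>N\<close>;
      \<open>A\<close> can be shifted down to it.\<close>
    define B where "B = {1..k - 2} \<union> {N + 1, N + 2}"
    have "B \<in> F"
    proof (rule dominated[OF AF])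
      show "B \<subseteq> {1..n}" using N_bounds unfolding B_def by auto
      have "card B = card {1..k - 2} + card {N + 1, N + 2}"
        unfolding B_def using N_bounds by (intro card_Un_disjoint) auto
      then show cB: "card B = k" using k3 by simp
      fix y
      consider "y \<le> k - 2" | "k - 2 < y" "y \<le> N" | "y = N + 1" | "y \<ge> N + 2" by linarith
      then show "card (A \<inter> {..y}) \<le> card (B \<inter> {..y})"
      proof cases
        case 1
        have "card (A \<inter> {..y}) \<le> card {1..y}" using An by (intro card_mono) auto
        also have "\<dots> \<le> card (B \<inter> {..y})" using 1 unfolding B_def by (intro card_mono) auto
        finally show ?thesis .
      next
        case 2
        have "card (A \<inter> {..y}) \<le> card (A \<inter> {1..N})" using An 2 by (intro card_mono) auto
        also have "\<dots> \<le> card {1..k - 2}" using cAN by simp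
        also have "\<dots> \<le> card (B \<inter> {..y})" using 2 unfolding B_def by (intro card_mono) auto
        finally show ?thesis .
      next
        case 3
        have "card (A \<inter> {..y}) \<le> card (insert (N + 1) (A \<inter> {1..N}))"
          using An 3 by (intro card_mono) auto
        also have "\<dots> \<le> Suc (k - 2)" using cAN by (metis An(2) Suc_le_mono card_insert_le_m1 card_insert_if finite_Int le_SucI)
        also have "\<dots> = card (insert (N + 1) {1..k - 2})" using N_bounds by simp
        also have "\<dots> \<le> card (B \<inter> {..y})" using 3 N_bounds unfolding B_def by (intro card_mono) auto
        finally show ?thesis .
      next
        case 4
        have "B \<inter> {..y} = B" using 4 N_bounds unfolding B_def by auto
        then show ?thesis using cB An card_mono[of A "A \<inter> {..y}"] by simp
      qed
    qed
    \<comment> \<open>\<open>B\<close> occupies only \<open>{1..k - 2}\<close> inside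
      \<open>{1..N}\<close>, so \<open>s\<close> disjoint members in the remaining
      \<open>k * s\<close> vertices would complete a matching of size \<open>s + 1\<close>.\<close>
    have "1 * (card {k - 1..N} choose k) \<le> s * card Mis"
    proof (rule card_Mis_lower)
      show "{k - 1..N} \<subseteq> {1..N}" using k3 by auto
      show "k * s \<le> card {k - 1..N}" using k3 unfolding N_def by simp
      fix \<C> assume C: "\<C> \<subseteq> F \<inter> nsets {k - 1..N} k" "pairwise disjnt \<C>"
      have "card \<C> + card {B} \<le> s"
      proof (rule matching_le_Un[OF match _ C(2) _ _ empty_notin_F finite_F])
        show "disjnt C G" if "C \<in> \<C>" "G \<in> {B}" for C G
          using that C(1) k3 unfolding B_def disjnt_def nsets_def by fastforce
      qed (use C \<open>B \<in> F\<close> in auto)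
      then show "card \<C> + 1 \<le> s" by simp
    qed
    moreover have "card {k - 1..N} = k * s" using k3 unfolding N_def by simp
    ultimately have "s * ((k * s - 1) choose (k - 1)) \<le> s * card Mis"
      using k_times_choose[of k s] k3 s3 by simp
    then have "(k * s - 1) choose (k - 1) \<le> card Mis" using s3 by simp
    moreover have "(k * (s - 1) - 1) choose (k - 1) \<le> (k * s - 1) choose (k - 1)"
      by (intro binomial_right_mono diff_le_mono mult_le_mono2) simp
    ultimately show False using few by simp
  qed
  have link_mono: "link x \<subseteq> link y" if "N < y" "y \<le> x" for x y
    using that by (auto simp: link_def nsets_def intro!: replace_last[of x _ y])
  have fin_link: "finite (link x)" for x
    unfolding link_def by (rule finite_subset[of _ "nsets {1..N} (k - 1)"])
      (auto simp: finite_imp_finite_nsets)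
  have Out_sub: "Out \<subseteq> (\<Union>x\<in>{N + 1..n}. insert x ` link x)"
  proof
    fix A assume A: "A \<in> Out"
    then have AF: "A \<in> F" and An: "A \<subseteq> {1..n}" "finite A" "card A = k"
      using F_mem unfolding Out_def by auto
    obtain x where x: "A - {1..N} = {x}" using one[OF A] by (auto simp: card_1_singleton_iff)
    have x': "x \<in> {N + 1..n}" using x An by fastforce
    have ins: "A = insert x (A - {x})" using x by blast
    have "x \<in> A" using x by blast
    then have "card (A - {x}) = k - 1" using An by simp
    then have "A - {x} \<in> nsets {1..N} (k - 1)" using x An unfolding nsets_def by blast
    then have "A - {x} \<in> link x" using AF ins unfolding link_def by simp
    then show "A \<in> (\<Union>x\<in>{N + 1..n}. insert x ` link x)" using x' ins by blast
  qed
  have "card Out \<le> card (\<Union>x\<in>{N + 1..n}. insert x ` link x)"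
    using fin_link by (intro card_mono[OF _ Out_sub]) auto
  also have "\<dots> \<le> (\<Sum>x\<in>{N + 1..n}. card (insert x ` link x))" by (rule card_UN_le) simp
  also have "\<dots> \<le> (\<Sum>x\<in>{N + 1..n}. card (link x))" using fin_link by (intro sum_mono card_image_le)
  also have "\<dots> = card (link (N + 1)) + (\<Sum>x\<in>{N + 2..n}. card (link x))"
    using N_bounds by (simp add: sum.atLeast_Suc_atMost)
  \<comment> \<open>The links decrease, so every vertex after \<open>N + 2\<close> is charged as
    \<open>N + 2\<close>.\<close>
  also have "(\<Sum>x\<in>{N + 2..n}. card (link x)) \<le> (\<Sum>x\<in>{N + 2..n}. card (link (N + 2)))"
    using link_mono fin_link by (intro sum_mono card_mono) auto
  also have "(\<Sum>x\<in>{N + 2..n}. card (link (N + 2))) = (n - N - 1) * card (link (N + 2))" by simp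
  finally have Out_le: "card Out \<le> card (link (N + 1)) + (n - N - 1) * card (link (N + 2))" by simp
  have "card (link (N + 1)) + (n - N - 1) * card (link (N + 2)) \<le>
      max ((card {1..N} choose (k - 1)) - ((card {1..N} - (k - 1)) choose (k - 1)) + (n - N - 1))
        ((n - N) * ((card {1..N} - 1) choose (k - 1 - 1)))"
  proof (rule cross_intersecting_weighted)
    show "link (N + 1) \<subseteq> nsets {1..N} (k - 1)" "link (N + 2) \<subseteq> nsets {1..N} (k - 1)"
      unfolding link_def by auto
    show "link (N + 2) \<noteq> {}"
    proof -
      have "{1..k - 1} \<in> nsets {1..N} (k - 1)" using N_bounds by (auto simp: nsets_def)
      then have "{1..k - 1} \<in> link (N + 2)" using initial_plus[of "N + 2"] N_bounds unfolding link_def by simp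
      then show ?thesis by blast
    qed
    show "card (link (N + 2)) \<le> card (link (N + 1))"
      using link_mono fin_link by (intro card_mono) auto
    show "2 \<le> n - N" using N_bounds by simp
    fix A B assume A: "A \<in> link (N + 1)" and B: "B \<in> link (N + 2)"
    show "A \<inter> B \<noteq> {}"
    proof
      assume AB: "A \<inter> B = {}"
      have A': "A \<subseteq> {1..N}" "finite A" "card A = k - 1" "insert (N + 1) A \<in> F"
        and B': "B \<subseteq> {1..N}" "finite B" "card B = k - 1" "insert (N + 2) B \<in> F"
        using A B unfolding link_def nsets_def by auto
      \<comment> \<open>Together the two members use \<open>2 * (k - 1)\<close> vertices of
        \<open>{1..N}\<close>, leaving exactly \<open>k * (s - 1)\<close>.\<close>
      let ?R = "{1..N} - (A \<union> B)"
      have "card (A \<union> B) = 2 * (k - 1)" using A' B' AB by (simp add: card_Un_disjoint)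
      then have "card ?R = N - 2 * (k - 1)" using A' B' by (subst card_Diff_subset) auto
      then have cR: "card ?R = k * (s - 1)" using k3 unfolding N_def by (simp add: algebra_simps)
      have "1 * (card ?R choose k) \<le> (s - 1) * card Mis"
      proof (rule card_Mis_lower)
        fix \<C> assume C: "\<C> \<subseteq> F \<inter> nsets ?R k" "pairwise disjnt \<C>"
        have "card \<C> + card {insert (N + 1) A, insert (N + 2) B} \<le> s"
        proof (rule matching_le_Un[OF match _ C(2) _ _ empty_notin_F finite_F])
          have "disjnt (insert (N + 1) A) (insert (N + 2) B)"
            using AB A' B' by (auto simp: disjnt_def)
          then show "pairwise disjnt {insert (N + 1) A, insert (N + 2) B}"
            by (intro pairwise_disjnt_insert) auto
          show "disjnt C G" if "C \<in> \<C>" "G \<in> {insert (N + 1) A, insert (N + 2) B}" for C G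
          proof -
            have "C \<subseteq> ?R" using that C(1) unfolding nsets_def by blast
            moreover have "G \<inter> ?R = {}" using that(2) by auto
            ultimately show ?thesis unfolding disjnt_def by blast
          qed
        qed (use C A' B' in auto)
        moreover have "insert (N + 1) A \<noteq> insert (N + 2) B" using A' B' by (metis atLeastAtMost_iff insertCI insertE n_not_Suc_n not_less_eq_eq add_2_eq_Suc' Suc_eq_plus1 subsetD order_refl)
        ultimately show "card \<C> + 1 \<le> s - 1" by simp
      qed (use cR in auto)
      then have "(s - 1) * ((k * (s - 1) - 1) choose (k - 1)) \<le> (s - 1) * card Mis"
        using cR k_times_choose[of k "s - 1"] k3 s3 by simp
      then have "(k * (s - 1) - 1) choose (k - 1) \<le> card Mis" using s3 by simp
      then show False using few by simp
    qed
  qed (use big k3 N_bounds in auto)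
  then show ?thesis using Out_le by (simp add: numeral_2_eq_2)
qed


section \<open>Many missing sets: how far right a member leaving \<open>{1..N}\<close> may
  start\<close>

definition window where "window p \<longleftrightarrow> insert (N + 1) {p..p + k - 2} \<in> F"

lemma window_1: "window 1"
proof -
  have "insert (N + 1) {1..k - 1} \<in> F" using N_bounds by (intro initial_plus) auto
  then show ?thesis unfolding window_def using k3 by simp
qed

text \<open>The set in \<open>window p\<close> is the lowest \<open>k\<close>-set that leaves
  \<open>{1..N}\<close> and avoids \<open>{1..p - 1}\<close>; any member of \<open>Out\<close>
  avoiding these vertices could be shifted down to it.\<close>

lemma Out_meets_initial:
  assumes "\<not> window p" "1 \<le> p" "p + k - 2 \<le> N" "A \<in> Out"
  shows "A \<inter> {1..p - 1} \<noteq> {}"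
proof
  assume emp: "A \<inter> {1..p - 1} = {}"
  have AF: "A \<in> F" and An: "A \<subseteq> {1..n}" "finite A" "card A = k"
    using assms(4) F_mem unfolding Out_def by auto
  have "A - {1..N} \<noteq> {}" using assms(4) An unfolding Out_def by (auto simp: nsets_def)
  then obtain x where x: "x \<in> A" "x > N" using An by fastforce
  have ge: "a \<ge> p" if "a \<in> A" for a
  proof (rule ccontr)
    assume "\<not> a \<ge> p"
    then have "a \<in> A \<inter> {1..p - 1}" using that An by auto
    then show False using emp by blast
  qed
  have "insert (N + 1) {p..p + k - 2} \<in> F"
  proof (rule dominated[OF AF])
    show "insert (N + 1) {p..p + k - 2} \<subseteq> {1..n}" using assms N_bounds by auto
    show cB: "card (insert (N + 1) {p..p + k - 2}) = k" using assms(3) k3 by simp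
    fix y
    consider "y \<le> p + k - 2" | "p + k - 2 < y" "y \<le> N" | "y > N" by linarith
    then show "card (A \<inter> {..y}) \<le> card (insert (N + 1) {p..p + k - 2} \<inter> {..y})"
    proof cases
      case 1
      have "card (A \<inter> {..y}) \<le> card {p..y}" using ge by (intro card_mono) auto
      also have "\<dots> \<le> card (insert (N + 1) {p..p + k - 2} \<inter> {..y})"
        using 1 by (intro card_mono) auto
      finally show ?thesis .
    next
      case 2
      have "card (A \<inter> {..y}) \<le> card (A - {x})" using An x 2 by (intro card_mono) auto
      also have "\<dots> = card {p..p + k - 2}" using x An k3 by simp
      also have "\<dots> \<le> card (insert (N + 1) {p..p + k - 2} \<inter> {..y})"
        using 2 by (intro card_mono) auto
      finally show ?thesis .
    next
      case 3
      have "insert (N + 1) {p..p + k - 2} \<inter> {..y} = insert (N + 1) {p..p + k - 2}"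
        using 3 assms(3) by auto
      then show ?thesis using cB An card_mono[of A "A \<inter> {..y}"] by simp
    qed
  qed
  then show False using assms(1) unfolding window_def by simp
qed

lemma card_Out_le:
  assumes "\<And>A. A \<in> Out \<Longrightarrow> A \<inter> {1..p} \<noteq> {}" "p \<le> N"
  shows "card Out \<le> p * (n - N) * n ^ (k - 2)"
proof -
  let ?X = "\<lambda>i x. {A \<in> nsets {1..n} k. {i, x} \<subseteq> A}"
  have sub: "Out \<subseteq> (\<Union>i\<in>{1..p}. \<Union>x\<in>{N + 1..n}. ?X i x)"
  proof
    fix A assume A: "A \<in> Out"
    then have AF: "A \<in> F" and An: "A \<subseteq> {1..n}" "finite A" "card A = k"
      using F_mem unfolding Out_def by auto
    have "A - {1..N} \<noteq> {}" using A An unfolding Out_def by (auto simp: nsets_def)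
    then obtain x where x: "x \<in> A" "x \<in> {N + 1..n}" using An by fastforce
    obtain i where "i \<in> A" "i \<in> {1..p}" using assms(1)[OF A] by blast
    then show "A \<in> (\<Union>i\<in>{1..p}. \<Union>x\<in>{N + 1..n}. ?X i x)" using x An by (auto simp: nsets_def)
  qed
  have X: "card (?X i x) \<le> n ^ (k - 2)" if "i \<in> {1..p}" "x \<in> {N + 1..n}" for i x
  proof -
    have "i \<noteq> x" "{i, x} \<subseteq> {1..n}" using that assms(2) N_bounds by auto
    then have "card (?X i x) = (n - 2) choose (k - 2)"
      using card_nsets_superset[of "{1..n}" "{i, x}" k] k3 by (simp add: numeral_2_eq_2)
    also have "\<dots> \<le> (n - 2) ^ (k - 2)" using N_bounds by (intro binomial_le_pow) simp
    also have "\<dots> \<le> n ^ (k - 2)" by (intro power_mono) auto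
    finally show ?thesis .
  qed
  have "card Out \<le> card (\<Union>i\<in>{1..p}. \<Union>x\<in>{N + 1..n}. ?X i x)"
    by (rule card_mono[OF _ sub]) (auto intro!: finite_imp_finite_nsets)
  also have "\<dots> \<le> (\<Sum>i\<in>{1..p}. card (\<Union>x\<in>{N + 1..n}. ?X i x))" by (rule card_UN_le) simp
  also have "\<dots> \<le> (\<Sum>i\<in>{1..p}. (n - N) * n ^ (k - 2))"
  proof (rule sum_mono)
    fix i assume i: "i \<in> {1..p}"
    have "card (\<Union>x\<in>{N + 1..n}. ?X i x) \<le> (\<Sum>x\<in>{N + 1..n}. card (?X i x))"
      by (rule card_UN_le) simp
    also have "\<dots> \<le> (\<Sum>x\<in>{N + 1..n}. n ^ (k - 2))" using X[OF i] by (rule sum_mono)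
    finally show "card (\<Union>x\<in>{N + 1..n}. ?X i x) \<le> (n - N) * n ^ (k - 2)" by simp
  qed
  finally show ?thesis by simp
qed

text \<open>For the case that windows reach as far as they are considered, so that no initial
  segment is known to be met.\<close>

lemma card_Out_le_trivial: "card Out \<le> (n - N) * n ^ (k - 1)"
proof -
  let ?X = "\<lambda>x. {A \<in> nsets {1..n} k. {x} \<subseteq> A}"
  have sub: "Out \<subseteq> (\<Union>x\<in>{N + 1..n}. ?X x)"
  proof
    fix A assume A: "A \<in> Out"
    then have AF: "A \<in> F" and An: "A \<subseteq> {1..n}" "finite A" "card A = k"
      using F_mem unfolding Out_def by auto
    have "A - {1..N} \<noteq> {}" using A An unfolding Out_def by (auto simp: nsets_def)
    then obtain x where x: "x \<in> A" "x \<in> {N + 1..n}" using An by fastforce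
    then show "A \<in> (\<Union>x\<in>{N + 1..n}. ?X x)" using An by (auto simp: nsets_def)
  qed
  have X: "card (?X x) \<le> n ^ (k - 1)" if "x \<in> {N + 1..n}" for x
  proof -
    have "{x} \<subseteq> {1..n}" using that by auto
    then have "card (?X x) = (n - 1) choose (k - 1)"
      using card_nsets_superset[of "{1..n}" "{x}" k] k3 by simp
    also have "\<dots> \<le> (n - 1) ^ (k - 1)" using N_bounds by (intro binomial_le_pow) simp
    also have "\<dots> \<le> n ^ (k - 1)" by (intro power_mono) auto
    finally show ?thesis .
  qed
  have "card Out \<le> card (\<Union>x\<in>{N + 1..n}. ?X x)"
    by (rule card_mono[OF _ sub]) (auto intro!: finite_imp_finite_nsets)
  also have "\<dots> \<le> (\<Sum>x\<in>{N + 1..n}. card (?X x))" by (rule card_UN_le) simp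
  also have "\<dots> \<le> (\<Sum>x\<in>{N + 1..n}. n ^ (k - 1))" using X by (rule sum_mono)
  finally show ?thesis by simp
qed

text \<open>All \<open>k - 1\<close>-subsets of \<open>{1..p + k - 2}\<close> extend by any vertex up to \<open>N + 1\<close>; hence \<open>q\<close> consecutive
  blocks can be completed to disjoint members of \<open>F\<close> using only \<open>N + 1\<close>, \<open>N + 2\<close> and \<open>q - 2\<close> further
  vertices, so that at most \<open>s - q\<close> disjoint members of \<open>F\<close> avoid the blocks inside \<open>{1..N}\<close>.\<close>

lemma few_disjoint_beyond_blocks:
  assumes win: "window p" "1 \<le> p" "(k - 1) * q \<le> p + k - 2" "p + k - 2 \<le> N" "2 \<le> q" "q \<le> s"
    and C: "\<C> \<subseteq> F \<inter> nsets {(k - 1) * q + 1..N} k" "pairwise disjnt \<C>"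
  shows "card \<C> \<le> s - q"
proof (rule ccontr)
  assume "\<not> card \<C> \<le> s - q"
  then have "s + 1 - q \<le> card \<C>" by simp
  then obtain \<D> where D: "\<D> \<subseteq> \<C>" "card \<D> = s + 1 - q" by (rule obtain_subset_with_card_n)
  let ?R = "{(k - 1) * q + 1..N}"
  have DR: "\<D> \<subseteq> F \<inter> nsets ?R k" using D C by blast
  have Dp: "pairwise disjnt \<D>" by (rule pairwise_subset[OF C(2) D(1)])
  have Dfin: "finite \<D>" using D(1) C(1) finite_F by (meson finite_Int finite_subset)
  have "card (\<Union>\<D>) = (\<Sum>A\<in>\<D>. card A)"
    by (rule card_Union_disjoint[OF Dp]) (use DR in \<open>auto simp: nsets_def\<close>)
  also have "\<dots> = (\<Sum>A\<in>\<D>. k)" using DR by (intro sum.cong) (auto simp: nsets_def)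
  also have "\<dots> = (s + 1 - q) * k" using D by simp
  finally have cUD: "card (\<Union>\<D>) = (s + 1 - q) * k" .
  have UD: "\<Union>\<D> \<subseteq> ?R" using DR by (auto simp: nsets_def)
  obtain w where w: "s = q + w" using assms(6) le_Suc_ex by blast
  obtain j where j: "k = Suc j" using k3 by (cases k) auto
  have "card (?R - \<Union>\<D>) = card ?R - card (\<Union>\<D>)"
    using UD by (intro card_Diff_subset) (auto intro: finite_subset)
  \<comment> \<open>Beside the blocks and \<D>, a ground set of \<open>k * (s + 1)\<close> vertices
    would have \<open>q\<close> vertices left; \<open>{1..N}\<close> is two short of that.\<close>
  also have "\<dots> = q - 2"
  proof -
    have "N + 2 = k * (q + w + 1)" using N_bounds(1) w by simp
    then have "N + 2 = j * q + q + (w + 1) * k" using j by (simp add: algebra_simps)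
    moreover have "card ?R = N - j * q" using j by simp
    ultimately show ?thesis using cUD w assms(5) by simp
  qed
  finally have "card (?R - \<Union>\<D>) = card {2..<q}" by simp
  then obtain y0 where y0: "bij_betw y0 {2..<q} (?R - \<Union>\<D>)"
    using finite_same_card_bij[of "{2..<q}" "?R - \<Union>\<D>"] by auto
  \<comment> \<open>Block 0 takes \<open>N + 2\<close>, since \<open>{1..k - 1}\<close> extends by
    every outer vertex; the other blocks lie below the window, which yields extra vertices up to
    \<open>N + 1\<close> only.\<close>
  define y where "y i = (if i = 0 then N + 2 else if i = 1 then N + 1 else y0 i)" for i
  define B where "B i = {(k - 1) * i + 1..(k - 1) * (i + 1)}" for i
  define G where "G i = insert (y i) (B i)" for i
  have y0R: "y0 i \<in> ?R - \<Union>\<D>" if "2 \<le> i" "i < q" for i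
    using y0 that by (auto simp: bij_betw_def)
  have yR: "(k - 1) * q < y i \<and> y i \<notin> \<Union>\<D> \<and> y i \<le> N + 2 \<and> (1 \<le> i \<longrightarrow> y i \<le> N + 1)" if "i < q" for i
  proof -
    consider "i = 0" | "i = 1" | "2 \<le> i" by linarith
    then show ?thesis
    proof cases
      case 3
      then show ?thesis using y0R[OF 3 that] unfolding y_def by auto
    qed (use assms(3,4) UD in \<open>auto simp: y_def\<close>)
  qed
  have y_inj: "y i \<noteq> y i'" if "i < i'" "i' < q" for i i'
  proof -
    have "i' = 1 \<or> (2 \<le> i' \<and> i < 2) \<or> (2 \<le> i \<and> 2 \<le> i')" using that by linarith
    then consider "i' = 1" | "2 \<le> i'" "i < 2" | "2 \<le> i" "2 \<le> i'" by blast
    then show ?thesis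
    proof cases
      case 1
      then show ?thesis using that by (auto simp: y_def)
    next
      case 2
      then have "y i' \<le> N" "y i > N" using y0R[of i'] that by (auto simp: y_def)
      then show ?thesis by simp
    next
      case 3
      then have "i \<in> {2..<q}" "i' \<in> {2..<q}" using that by auto
      then have "y0 i \<noteq> y0 i'" using y0 that(1) unfolding bij_betw_def inj_on_def by blast
      then show ?thesis using 3 by (simp add: y_def)
    qed
  qed
  have B_le: "B i \<subseteq> {1..(k - 1) * q}" if "i < q" for i
  proof -
    have "(k - 1) * (i + 1) \<le> (k - 1) * q" using that by (intro mult_le_mono2) simp
    then show ?thesis unfolding B_def by auto
  qed
  have B_card: "card (B i) = k - 1" for i unfolding B_def by simp
  have B_disj: "B i \<inter> B i' = {}" if "i < i'" for i i'
  proof -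
    have "(k - 1) * (i + 1) \<le> (k - 1) * i'" using that by (intro mult_le_mono2) simp
    then show ?thesis unfolding B_def by auto
  qed
  have yB: "y i \<notin> B i'" if "i < q" "i' < q" for i i'
    using yR[OF that(1)] B_le[OF that(2)] by auto
  have G_F: "G i \<in> F" if i: "i < q" for i
  proof (cases "i = 0")
    case True
    then have "G i = insert (N + 2) {1..k - 1}" unfolding G_def B_def y_def by simp
    then show ?thesis using initial_plus[of "N + 2"] N_bounds by simp
  next
    case False
    let ?A = "insert (N + 1) {p..p + k - 2}"
    have Bp: "B i \<subseteq> {1..p + k - 2}" using B_le[OF i] assms(3) by auto
    have finB: "finite (B i)" unfolding B_def by simp
    show ?thesis
    proof (rule dominated)
      show "?A \<in> F" using win(1) unfolding window_def .
      show "G i \<subseteq> {1..n}" unfolding G_def using yR[OF i] Bp assms(4) N_bounds by auto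
      show cG: "card (G i) = k" unfolding G_def using yB[OF i i] finB B_card k3 by simp
      fix z
      have "card (?A \<inter> {..z}) \<le> card (B i \<inter> {..z})" if z: "z \<le> N"
      proof (cases "z \<le> p + k - 2")
        case True
        have "?A \<inter> {..z} = {p..z}" using True z by auto
        moreover have "k - 1 \<le> card (B i \<inter> {..z}) + card {z + 1..p + k - 2}"
        proof -
          have "k - 1 = card (B i)" using B_card by simp
          also have "\<dots> \<le> card ((B i \<inter> {..z}) \<union> {z + 1..p + k - 2})"
            using Bp finB by (intro card_mono) auto
          also have "\<dots> \<le> card (B i \<inter> {..z}) + card {z + 1..p + k - 2}" by (rule card_Un_le)
          finally show ?thesis .
        qed
        ultimately show ?thesis using True k3 by simp
      next
        case False
        have "?A \<inter> {..z} = {p..p + k - 2}" using False z by auto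
        moreover have "B i \<inter> {..z} = B i" using False Bp by auto
        ultimately show ?thesis using B_card k3 by simp
      qed
      moreover have "card (B i \<inter> {..z}) \<le> card (G i \<inter> {..z})"
        unfolding G_def using finB by (intro card_mono) auto
      moreover have "card (?A \<inter> {..z}) \<le> card (G i \<inter> {..z})" if z: "z > N"
      proof -
        have "G i \<inter> {..z} = G i" unfolding G_def using yR[OF i] False Bp assms(4) z by auto
        moreover have "card (?A \<inter> {..z}) \<le> card ?A" by (intro card_mono) auto
        moreover have "card ?A = k" using assms(4) k3 by simp
        ultimately show ?thesis using cG by simp
      qed
      ultimately show "card (?A \<inter> {..z}) \<le> card (G i \<inter> {..z})" by (meson le_trans not_le)
    qed
  qed
  have G_disj: "disjnt (G i) (G i')" if "i < i'" "i' < q" for i i'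
    using y_inj[OF that] B_disj[OF that(1)] yB[of i i'] yB[of i' i] that
    unfolding G_def disjnt_def by auto
  have G_dis: "disjnt (G i) (G i')" if "i < q" "i' < q" "i \<noteq> i'" for i i'
    using G_disj[of i i'] G_disj[of i' i] that disjnt_sym by (metis nat_neq_iff)
  have "inj_on G {..<q}"
  proof (rule inj_onI)
    fix i i' assume "i \<in> {..<q}" "i' \<in> {..<q}" "G i = G i'"
    then show "i = i'" using G_dis[of i i'] unfolding G_def disjnt_def by force
  qed
  then have cG: "card (G ` {..<q}) = q" by (simp add: card_image)
  have "card \<D> + card (G ` {..<q}) \<le> s"
  proof (rule matching_le_Un[OF match _ Dp _ _ empty_notin_F finite_F])
    show "\<D> \<union> G ` {..<q} \<subseteq> F" using DR G_F by auto
    show "pairwise disjnt (G ` {..<q})"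
      using G_dis by (auto intro!: pairwise_imageI)
    show "disjnt C A" if CD: "C \<in> \<D>" and AG: "A \<in> G ` {..<q}" for C A
    proof -
      obtain i where i: "i < q" "A = G i" using AG by blast
      have "C \<subseteq> ?R" using CD DR unfolding nsets_def by blast
      then have "C \<inter> B i = {}" using B_le[OF i(1)] by fastforce
      moreover have "y i \<notin> C" using yR[OF i(1)] CD by blast
      ultimately show ?thesis unfolding i(2) G_def disjnt_def by blast
    qed
  qed
  then show False using cG D(2) assms(6) by simp
qed

text \<open>The vertices after the blocks number \<open>k * (s + 1 - q) + (q - 2)\<close>, so they
  hold \<open>s + 1 - q + (q - 2) div k\<close> disjoint \<open>k\<close>-sets, of which at most
  \<open>s - q\<close> belong to \<open>F\<close>.\<close>

lemma card_Mis_blocks: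
  assumes "window p" "1 \<le> p" "(k - 1) * q \<le> p + k - 2" "p + k - 2 \<le> N" "2 \<le> q" "q \<le> s"
  shows "(1 + (q - 2) div k) * ((N - (k - 1) * q) choose k) \<le> s * card Mis"
proof -
  let ?R = "{(k - 1) * q + 1..N}"
  let ?m = "s + 1 - q + (q - 2) div k"
  obtain w where w: "s = q + w" using assms(6) le_Suc_ex by blast
  obtain j where j: "k = Suc j" using k3 by (cases k) auto
  have "(1 + (q - 2) div k) * (card ?R choose k) \<le> ?m * card Mis"
  proof (rule card_Mis_lower)
    show "?R \<subseteq> {1..N}" by auto
    show "k * ?m \<le> card ?R"
    proof -
      have "N + 2 = k * (q + w + 1)" using N_bounds(1) w by simp
      then have "N + 2 = j * q + q + k * (w + 1)" using j by (simp add: algebra_simps)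
      then have "card ?R = k * (w + 1) + (q - 2)" using j assms(5) by simp
      moreover have "k * ?m = k * (w + 1) + k * ((q - 2) div k)" using w by (simp add: algebra_simps)
      moreover have "k * ((q - 2) div k) \<le> q - 2" by simp
      ultimately show ?thesis by linarith
    qed
    fix \<C> assume "\<C> \<subseteq> F \<inter> nsets ?R k" "pairwise disjnt \<C>"
    then have "card \<C> \<le> s - q" using few_disjoint_beyond_blocks[OF assms] by simp
    then show "card \<C> + (1 + (q - 2) div k) \<le> ?m" using assms(6) by simp
  qed
  also have "\<dots> \<le> s * card Mis"
  proof (intro mult_le_mono1)
    have "(q - 2) div k \<le> q - 2" by simp
    then show "?m \<le> s" using assms(5,6) by linarith
  qed
  finally show ?thesis by simp
qed

text \<open>Both sides are compared with \<open>p\<close>, the last position of a window up to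
  \<open>N div 4\<close>: up to factors depending on \<open>k\<close>, \<open>Out\<close> has at
  most \<open>p * (n - N) * n ^ (k - 2)\<close> and \<open>Mis\<close> at least
  \<open>p * N ^ (k - 1)\<close> members.\<close>

lemma Out_many_missing:
  assumes many: "(k * (s - 1) - 1) choose (k - 1) \<le> card Mis"
    and t: "16 * 2 ^ k * (2 * k) ^ k * (2 * k * k) * (n - N) \<le> N"
    and N_big: "4 * k \<le> N"
  shows "card Out \<le> card Mis"
proof -
  \<comment> \<open>The factor \<open>16 * 2 ^ k\<close> is lost in bounding \<open>Out\<close> with
    \<open>n \<le> 2 * N\<close>, the rest in bounding \<open>Mis\<close> from below.\<close>
  define c where "c = 16 * 2 ^ k * (2 * k) ^ k * (2 * k * k)"
  have c1: "c \<ge> 1" unfolding c_def using k3 by simp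
  have "1 * (n - N) \<le> c * (n - N)" using c1 by (rule mult_le_mono1)
  then have n2N: "n \<le> 2 * N" using t unfolding c_def[symmetric] by linarith
  \<comment> \<open>This cap keeps the blocks in the first half of \<open>{1..N}\<close>, and
    \<open>N \<le> 8 * pm\<close> gives \<open>n \<le> 16 * p\<close> once it is reached.\<close>
  define pm where "pm = N div 4"
  have pm: "1 \<le> pm" "4 * pm \<le> N" "N \<le> 8 * pm" using N_big k3 unfolding pm_def by auto
  define p where "p = Max {p \<in> {1..pm}. window p}"
  have ne: "{p \<in> {1..pm}. window p} \<noteq> {}" using window_1 pm by auto
  have p: "1 \<le> p" "p \<le> pm" "window p"
    using Max_in[OF _ ne] unfolding p_def by auto
  have pmax: "x \<le> p" if "window x" "1 \<le> x" "x \<le> pm" for x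
    unfolding p_def using that by (intro Max_ge) auto
  have Out1: "card Out \<le> 16 * p * (n - N) * n ^ (k - 2)"
  proof (cases "p = pm")
    case True
    have "n ^ (k - 1) = n * n ^ (k - 2)" using k3 by (metis Suc_diff_le power_Suc numeral_3_eq_3 diff_Suc_Suc eval_nat_numeral(2) Suc_leD Suc_1 diff_Suc_1 One_nat_def)
    then have "card Out \<le> (n - N) * (n * n ^ (k - 2))" using card_Out_le_trivial by simp
    also have "\<dots> \<le> (n - N) * (16 * p * n ^ (k - 2))"
      using True n2N pm by (intro mult_le_mono2 mult_le_mono1) linarith
    finally show ?thesis by (simp add: algebra_simps)
  next
    case False
    then have "\<not> window (p + 1)" using pmax[of "p + 1"] p by auto
    then have "A \<inter> {1..p} \<noteq> {}" if "A \<in> Out" for A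
      using Out_meets_initial[of "p + 1" A] that p pm N_big by auto
    then have "card Out \<le> p * (n - N) * n ^ (k - 2)"
      using p pm by (intro card_Out_le) auto
    then show ?thesis by simp
  qed
  have pw: "N * N ^ (k - 2) = N ^ (k - 1)"
    using k3 by (metis Suc_diff_le power_Suc numeral_3_eq_3 diff_Suc_Suc eval_nat_numeral(2) Suc_leD Suc_1 diff_Suc_1 One_nat_def)
  have "c * card Out \<le> c * (16 * p * (n - N) * n ^ (k - 2))" using Out1 by simp
  also have "\<dots> = 16 * p * (c * (n - N)) * n ^ (k - 2)" by (simp add: algebra_simps)
  also have "\<dots> \<le> 16 * p * N * (2 * N) ^ (k - 2)"
    using t n2N unfolding c_def[symmetric] by (intro mult_le_mono power_mono) auto
  also have "\<dots> = 16 * p * 2 ^ (k - 2) * N ^ (k - 1)"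
    unfolding pw[symmetric] power_mult_distrib by (simp add: algebra_simps)
  also have "\<dots> \<le> 16 * p * 2 ^ k * N ^ (k - 1)"
    by (intro mult_le_mono1 mult_le_mono2 power_increasing) auto
  finally have Out2: "c * card Out \<le> 16 * 2 ^ k * (p * N ^ (k - 1))" by (simp add: algebra_simps)
  \<comment> \<open>For \<open>p < k\<close> there is no room for two blocks and \<open>many\<close>
    suffices; otherwise the blocks are used.\<close>
  have "p * N ^ (k - 1) \<le> (2 * k) ^ k * (2 * k * k) * card Mis"
  proof (cases "p < k")
    case True
    have "k * 3 \<le> k * s" using s3 by (rule mult_le_mono2)
    moreover have "k * (s - 1) = k * s - k" by (simp add: diff_mult_distrib2)
    ultimately have N2': "N \<le> 2 * (k * (s - 1) - 1)"
      unfolding N_def using k3 by linarith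
    have kk: "k - 1 \<le> k * (s - 1) - 1" 
    proof (rule diff_le_mono)
      have "k * 1 \<le> k * (s - 1)" using s3 by (intro mult_le_mono2) simp
      then show "k \<le> k * (s - 1)" by simp
    qed
    have "N ^ (k - 1) \<le> (2 * (k * (s - 1) - 1)) ^ (k - 1)" using N2' by (intro power_mono) auto
    also have "\<dots> = 2 ^ (k - 1) * (k * (s - 1) - 1) ^ (k - 1)" by (rule power_mult_distrib)
    also have "\<dots> \<le> 2 ^ (k - 1) * ((k - 1) ^ (k - 1) * ((k * (s - 1) - 1) choose (k - 1)))"
      using kk k3 by (intro mult_le_mono2 power_le_binomial) auto
    also have "\<dots> \<le> 2 ^ (k - 1) * (k ^ (k - 1) * card Mis)"
      using many by (intro mult_le_mono2 mult_le_mono power_mono) auto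
    also have "\<dots> = (2 * k) ^ (k - 1) * card Mis" by (simp add: power_mult_distrib)
    finally have "p * N ^ (k - 1) \<le> k * ((2 * k) ^ (k - 1) * card Mis)"
      using True by (intro mult_le_mono) auto
    also have "\<dots> \<le> (2 * k * k) * ((2 * k) ^ k * card Mis)"
      using k3 by (intro mult_le_mono power_increasing) auto
    finally show ?thesis by (simp add: algebra_simps)
  next
    case False
    \<comment> \<open>As many blocks of length \<open>k - 1\<close> as fit into
      \<open>{1..p + k - 2}\<close>; after rounding down they still cover
      \<open>{1..p}\<close>.\<close>
    define q where "q = (p + k - 2) div (k - 1)"
    define d where "d = 1 + (q - 2) div k"
    have q1: "(k - 1) * q \<le> p + k - 2" unfolding q_def by simp
    have q2: "p \<le> (k - 1) * q"
    proof -
      have "p + k - 2 = (k - 1) * q + (p + k - 2) mod (k - 1)" unfolding q_def by simp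
      moreover have "(p + k - 2) mod (k - 1) < k - 1" using k3 by (intro mod_less_divisor) simp
      ultimately show ?thesis using k3 by linarith
    qed
    have qge: "2 \<le> q"
    proof -
      have "(k - 1) * 2 \<le> p + k - 2" using False k3 by simp
      then show ?thesis unfolding q_def using k3 by (simp add: less_eq_div_iff_mult_less_eq mult.commute)
    qed
    have pk: "2 * (p + k - 2) \<le> N" using p pm N_big by linarith
    have qs: "q \<le> s"
    proof (rule ccontr)
      assume "\<not> q \<le> s"
      then have "(k - 1) * (s + 1) \<le> (k - 1) * q" by (intro mult_le_mono2) simp
      then have "2 * ((k - 1) * (s + 1)) \<le> N" using q1 pk by linarith
      moreover have "k * (s + 1) \<le> 2 * ((k - 1) * (s + 1))"
      proof -
        have "k \<le> 2 * (k - 1)" using k3 by simp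
        then have "k * (s + 1) \<le> (2 * (k - 1)) * (s + 1)" by (rule mult_le_mono1)
        then show ?thesis by (simp add: mult.assoc)
      qed
      ultimately show False using N_bounds(1) by linarith
    qed
    let ?r = "N - (k - 1) * q"
    have r: "N \<le> 2 * ?r" "k \<le> ?r" using q1 pk N_big by linarith+
    have main: "d * (?r choose k) \<le> s * card Mis"
      unfolding d_def using card_Mis_blocks[OF p(3,1) q1 _ qge qs] pk by simp
    have pd: "p \<le> 2 * k * k * d"
    proof -
      have "q - 2 = k * ((q - 2) div k) + (q - 2) mod k" by simp
      moreover have "(q - 2) mod k < k" using k3 by (intro mod_less_divisor) simp
      moreover have "k * d = k + k * ((q - 2) div k)" unfolding d_def by simp
      ultimately have "q - 1 \<le> k * d" using qge by linarith
      then have "q \<le> 2 * (k * d)" using qge by linarith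
      then have "(k - 1) * q \<le> k * (2 * (k * d))" by (intro mult_le_mono) auto
      then show ?thesis using q2 by (simp add: algebra_simps)
    qed
    \<comment> \<open>The additional factor \<open>N\<close> absorbs the \<open>s\<close> in
      \<open>main\<close>, as \<open>s \<le> N\<close>.\<close>
    have "N * (p * N ^ (k - 1)) = p * N ^ k" using k3 by (simp add: power_eq_if)
    also have "\<dots> \<le> (2 * k * k * d) * (2 * ?r) ^ k"
      using pd r by (intro mult_le_mono power_mono) auto
    also have "\<dots> = (2 * k * k * d) * (2 ^ k * ?r ^ k)" by (simp add: power_mult_distrib)
    also have "\<dots> \<le> (2 * k * k * d) * (2 ^ k * (k ^ k * (?r choose k)))"
      using r k3 by (intro mult_le_mono2 power_le_binomial) auto
    also have "\<dots> = (2 * k * k) * (2 * k) ^ k * (d * (?r choose k))"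
      by (simp add: power_mult_distrib algebra_simps)
    also have "\<dots> \<le> (2 * k * k) * (2 * k) ^ k * (N * card Mis)"
    proof -
      have "s \<le> k * s" using k3 by simp
      then have "s \<le> N" unfolding N_def using k3 by linarith
      then have "s * card Mis \<le> N * card Mis" by (rule mult_le_mono1)
      then show ?thesis using main by (intro mult_le_mono2) linarith
    qed
    also have "\<dots> = N * ((2 * k) ^ k * (2 * k * k) * card Mis)" by (simp add: algebra_simps)
    finally have "N * (p * N ^ (k - 1)) \<le> N * ((2 * k) ^ k * (2 * k * k) * card Mis)" .
    then show ?thesis using N_bounds(3) by (metis mult_le_cancel1 add_is_0 le_zero_eq neq0_conv zero_neq_numeral)
  qed
  then have "16 * 2 ^ k * (p * N ^ (k - 1)) \<le> 16 * 2 ^ k * ((2 * k) ^ k * (2 * k * k) * card Mis)"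
    by (rule mult_le_mono2)
  also have "\<dots> = c * card Mis" unfolding c_def by (simp add: algebra_simps)
  finally have "c * card Out \<le> c * card Mis" using Out2 by linarith
  then show ?thesis using c1 by simp
qed

lemma card_F_le:
  assumes "4 * ((k - 1) * (k - 1)) * ((N - 2) choose (k - 3)) \<le> (N - 1) choose (k - 2)"
    and "16 * 2 ^ k * (2 * k) ^ k * (2 * k * k) * (n - N) \<le> N" "4 * k \<le> N"
  shows "card F \<le> (N choose k) +
      max ((N choose (k - 1)) - ((N - (k - 1)) choose (k - 1)) + (n - N - 1))
        ((n - N) * ((N - 1) choose (k - 2)))"
proof (cases "card Mis < (k * (s - 1) - 1) choose (k - 1)")
  case True
  have "k - 1 - 2 = k - 3" "k - 1 - 1 = k - 2" by auto
  then show ?thesis using Out_few_missing[OF True] assms(1) card_F by simp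
next
  case False
  then show ?thesis using Out_many_missing[OF _ assms(2,3)] card_F by simp
qed

end

subsection \<open>Reduction to shifted families\<close>

text \<open>The arguments of \<open>max\<close> count the members leaving \<open>{1..N}\<close> in
  \<open>E0\<close> and in \<open>E1\<close>.\<close>

definition nontrivial_bound :: "nat \<Rightarrow> nat \<Rightarrow> nat \<Rightarrow> nat" where
  "nontrivial_bound k N n = (N choose k) +
     max ((N choose (k - 1)) - ((N - (k - 1)) choose (k - 1)) + (n - N - 1))
       ((n - N) * ((N - 1) choose (k - 2)))"

lemma nontrivial_bound_mono: "n \<le> n' \<Longrightarrow> nontrivial_bound k N n \<le> nontrivial_bound k N n'"
  unfolding nontrivial_bound_def
  by (intro add_left_mono max.mono mult_le_mono1 diff_le_mono) auto

text \<open>The resulting set is the lowest \<open>k\<close>-set with largest element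
  \<open>x\<close>. Here \<open>x\<close> may exceed \<open>m\<close>, because only the other
  elements of \<open>A\<close> have to move.\<close>

lemma shifted_on_initial:
  assumes "shifted_on m F" "A \<in> F" "card A = k" "1 \<le> k" "x \<in> A" "A \<subseteq> {1..x}" "A - {x} \<subseteq> {1..m}"
    "k - 1 \<le> m"
  shows "insert x {1..k - 1} \<in> F"
proof -
  have fA: "finite A" using assms(6) finite_subset by blast
  have kx: "k \<le> x" using assms(3) card_mono[OF _ assms(6)] by simp
  have cB: "card (insert x {1..k - 1}) = k" using kx assms(4) by (subst card_insert_disjoint) auto
  have dom: "card (A \<inter> {..y}) \<le> card (insert x {1..k - 1} \<inter> {..y})" for y
  proof (cases "x \<le> y")
    case True
    have "insert x {1..k - 1} \<inter> {..y} = insert x {1..k - 1}" using True kx by auto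
    then show ?thesis using cB assms(3) card_mono[OF fA, of "A \<inter> {..y}"] by simp
  next
    case False
    have "card (A \<inter> {..y}) \<le> card {1..y}" using assms(6) by (intro card_mono) auto
    moreover have "card (A \<inter> {..y}) \<le> card (A - {x})" using False fA by (intro card_mono) auto
    ultimately have "card (A \<inter> {..y}) \<le> card {1..min y (k - 1)}" using assms(3,5) fA by simp
    also have "\<dots> \<le> card (insert x {1..k - 1} \<inter> {..y})" by (intro card_mono) auto
    finally show ?thesis .
  qed
  show ?thesis
    by (rule shifted_on_dominated[OF assms(1,2)]) (use assms fA cB dom in auto)
qed

lemma shifted_on_of_fixed:
  assumes "\<And>a b. 1 \<le> a \<Longrightarrow> a < b \<Longrightarrow> b \<le> m \<Longrightarrow> shift a b F = F"
  shows "shifted_on m F"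
  unfolding shifted_on_def
proof (intro ballI allI impI)
  fix A a b assume "A \<in> F" "1 \<le> a" "a < b" "b \<le> m" "b \<in> A" "a \<notin> A"
  then show "insert a (A - {b}) \<in> F" using shift_fixed_mem[OF assms] by blast
qed

lemma matching_le_image:
  assumes "inj_on f V" "F \<subseteq> Pow V" "matching_le F s"
  shows "matching_le ((`) f ` F) s"
  unfolding matching_le_def
proof (intro allI impI)
  fix M assume M: "M \<subseteq> (`) f ` F" "pairwise disjnt M"
  define M' where "M' = {A \<in> F. f ` A \<in> M}"
  have img: "M = (`) f ` M'" unfolding M'_def using M(1) by auto
  have inj: "inj_on ((`) f) (Pow V)" by (rule inj_on_image_Pow[OF assms(1)])
  then have inj': "inj_on ((`) f) M'" using assms(2) unfolding M'_def by (auto intro: inj_on_subset)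
  have "pairwise disjnt M'"
    unfolding pairwise_def
  proof (intro ballI impI)
    fix A B assume AB: "A \<in> M'" "B \<in> M'" "A \<noteq> B"
    then have "f ` A \<noteq> f ` B" using inj' by (auto dest: inj_onD)
    then have "disjnt (f ` A) (f ` B)" using AB pairwiseD[OF M(2)] unfolding M'_def by simp
    then show "disjnt A B" unfolding disjnt_def by blast
  qed
  moreover have "M' \<subseteq> F" unfolding M'_def by blast
  ultimately have "card M' \<le> s" using assms(3) unfolding matching_le_def by blast
  then show "card M \<le> s" unfolding img using inj' by (simp add: card_image)
qed

lemma nsets_image:
  assumes "inj_on f V" "A \<in> nsets V k"
  shows "f ` A \<in> nsets (f ` V) k"
  using assms by (auto simp: nsets_def card_image inj_on_subset)

text \<open>Deleting an isolated vertex leaves a ground set that need not be an initial interval;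
  the induction returns to one by renaming vertices.\<close>

lemma relabel:
  assumes "bij_betw f V W" "F \<subseteq> nsets V k" "\<Union>F = V" "matching_le F s"
  shows "(`) f ` F \<subseteq> nsets W k" "\<Union>((`) f ` F) = W" "matching_le ((`) f ` F) s"
    "card ((`) f ` F) = card F"
proof -
  have inj: "inj_on f V" and im: "f ` V = W" using assms(1) by (auto simp: bij_betw_def)
  have FP: "F \<subseteq> Pow V" using assms(3) by blast
  show "(`) f ` F \<subseteq> nsets W k" using nsets_image[OF inj] assms(2) im by blast
  show "\<Union>((`) f ` F) = W" using im assms(3) by blast
  show "matching_le ((`) f ` F) s" by (rule matching_le_image[OF inj FP assms(4)])
  show "card ((`) f ` F) = card F"
    by (rule card_image[OF inj_on_subset[OF inj_on_image_Pow[OF inj] FP]])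
qed

text \<open>Collects what is used of large \<open>s\<close>; \<open>n\<close> is left free because
  the induction varies it.\<close>

locale large_matching_bound =
  fixes k s N :: nat
  assumes k3: "k \<ge> 3" and s3: "s \<ge> 3" and N_eq: "N = k * s + k - 2"
    and N_big: "4 * k \<le> N"
    and binom: "4 * ((k - 1) * (k - 1)) * ((N - 2) choose (k - 3)) \<le> (N - 1) choose (k - 2)"
begin

definition close_to :: "nat \<Rightarrow> bool" where
  "close_to n \<longleftrightarrow> 16 * 2 ^ k * (2 * k) ^ k * (2 * k * k) * (n - N) \<le> N"

lemma close_to_mono: "close_to n \<Longrightarrow> m \<le> n \<Longrightarrow> close_to m"
  unfolding close_to_def by (meson diff_le_mono le_trans mult_le_mono2)

lemma N_plus_2: "N + 2 = k * s + k"
  using k3 unfolding N_eq by simp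

lemma shifted_bound:
  assumes "n \<ge> N + 2" "close_to n" "F \<subseteq> nsets {1..n} k" "shifted_on n F" "matching_le F s"
    "insert n {1..k - 1} \<in> F"
  shows "card F \<le> nontrivial_bound k N n"
proof -
  interpret shifted_family k s n F
    using k3 s3 assms N_plus_2 by unfold_locales auto
  have NN: "shifted_family.N k s = N" by (simp add: N_def N_eq)
  show ?thesis
    unfolding nontrivial_bound_def
    by (rule card_F_le[unfolded NN, OF binom assms(2)[unfolded close_to_def] N_big])
qed

text \<open>Here \<open>N + 1\<close> and \<open>N + 2\<close> play the pair whose shift isolated a
  vertex, and \<open>out\<close> records what disjointness of their links gives. Shifts among
  \<open>{1..N}\<close> do not touch these two vertices and preserve \<open>out\<close>,
  \<open>c1\<close> and \<open>c2\<close>.\<close>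

lemma base_bound:
  assumes close: "close_to (N + 2)" and F: "F \<subseteq> nsets {1..N + 2} k" "matching_le F s"
    and out: "card (F - nsets {1..N} k) \<le> N choose (k - 1)"
    and c1: "\<exists>A\<in>F. A \<inter> {N + 1, N + 2} = {N + 1}" and c2: "\<exists>A\<in>F. A \<inter> {N + 1, N + 2} = {N + 2}"
  shows "card F \<le> nontrivial_bound k N (N + 2)"
proof -
  define Inv where "Inv G \<longleftrightarrow> G \<subseteq> nsets {1..N + 2} k \<and> matching_le G s \<and> card G = card F
      \<and> card (G - nsets {1..N} k) \<le> N choose (k - 1)
      \<and> (\<exists>A\<in>G. A \<inter> {N + 1, N + 2} = {N + 1}) \<and> (\<exists>A\<in>G. A \<inter> {N + 1, N + 2} = {N + 2})" for G
  have sub_fin: "finite G \<and> (\<forall>A\<in>G. finite A)" if "G \<subseteq> nsets {1..N + 2} k" for G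
    using that finite_subset[OF that finite_imp_finite_nsets] by (auto simp: nsets_def)
  have start: "Inv F" unfolding Inv_def using F out c1 c2 by blast
  have fin: "finite G \<and> (\<forall>A\<in>G. finite A)" if "Inv G" for G using that sub_fin unfolding Inv_def by blast
  obtain G where G: "Inv G" and stable: "\<And>a b. a < b \<Longrightarrow> Inv (shift a b G) \<Longrightarrow> shift a b G = G"
    by (rule ex_shift_stable[of Inv, OF start fin]) (assumption | rule that)+
  have Gs: "G \<subseteq> nsets {1..N + 2} k" "matching_le G s" "card G = card F"
    "card (G - nsets {1..N} k) \<le> N choose (k - 1)" using G unfolding Inv_def by auto
  have fG: "finite G" using sub_fin Gs by blast
  have sh: "shifted_on N G"
  proof (rule shifted_on_of_fixed)
    fix a b :: nat assume ab: "1 \<le> a" "a < b" "b \<le> N"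
    have keep: "shift_set a b G A \<inter> {N + 1, N + 2} = A \<inter> {N + 1, N + 2}" for A
      using ab unfolding shift_set_def by auto
    have "shift a b G - nsets {1..N} k \<subseteq> shift_set a b G ` (G - nsets {1..N} k)"
    proof
      fix X assume X: "X \<in> shift a b G - nsets {1..N} k"
      then obtain A where A: "A \<in> G" "X = shift_set a b G A" unfolding shift_def by blast
      have "A \<notin> nsets {1..N} k"
        using shift_set_nsets[of A "{1..N}" k a b G] X A ab by auto
      then show "X \<in> shift_set a b G ` (G - nsets {1..N} k)" using A by blast
    qed
    then have "card (shift a b G - nsets {1..N} k) \<le> card (shift_set a b G ` (G - nsets {1..N} k))"
      using fG by (intro card_mono) auto
    also have "\<dots> \<le> card (G - nsets {1..N} k)" using fG by (intro card_image_le) auto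
    finally have o: "card (shift a b G - nsets {1..N} k) \<le> N choose (k - 1)" using Gs(4) by simp
    have cov: "\<exists>A\<in>shift a b G. A \<inter> {N + 1, N + 2} = Y"
      if "\<exists>A\<in>G. A \<inter> {N + 1, N + 2} = Y" for Y
      using that keep unfolding shift_def by auto
    have "Inv (shift a b G)"
      unfolding Inv_def using G o cov shift_nsets[OF Gs(1)] ab
      by (auto simp: Inv_def card_shift matching_le_shift[OF fG])
    then show "shift a b G = G" using stable ab by blast
  qed
  \<comment> \<open>Such a member has all its other vertices in \<open>{1..N}\<close>, where
    \<open>G\<close> is shifted, so these can be lowered while \<open>x\<close> stays.\<close>
  have init: "insert x {1..k - 1} \<in> G" if x: "x = N + 1 \<or> x = N + 2" for x
  proof -
    obtain A where A: "A \<in> G" "A \<inter> {N + 1, N + 2} = {x}" using x G unfolding Inv_def by blast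
    have Ap: "A \<subseteq> {1..N + 2}" "card A = k" using A(1) Gs(1) by (auto simp: nsets_def)
    have x_in: "x \<in> A" using A(2) by blast
    have A1: "A - {x} \<subseteq> {1..N}"
    proof
      fix z assume z: "z \<in> A - {x}"
      then have "z \<notin> {N + 1, N + 2}" using A(2) by blast
      moreover have "z \<in> {1..N + 2}" using z Ap by blast
      ultimately show "z \<in> {1..N}" by auto
    qed
    have "A \<subseteq> insert x {1..N}" using A1 by blast
    then have A2: "A \<subseteq> {1..x}" using x by fastforce
    show ?thesis
      by (rule shifted_on_initial[OF sh A(1) Ap(2) _ x_in A2 A1]) (use k3 N_big in auto)
  qed
  show ?thesis
  proof (cases "insert N {1..k - 1} \<in> G")
    case False
    \<comment> \<open>No member inside \<open>{1..N}\<close> contains \<open>N\<close>, as it could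
      be lowered to \<open>insert N {1..k - 1}\<close>. Counting \<open>k\<close>-sets in
      \<open>{1..N - 1}\<close> and using \<open>out\<close> then stays below the value for
      \<open>E1\<close>.\<close>
    have sub: "G \<subseteq> nsets {1..N - 1} k \<union> (G - nsets {1..N} k)"
    proof
      fix A assume A: "A \<in> G"
      show "A \<in> nsets {1..N - 1} k \<union> (G - nsets {1..N} k)"
      proof (cases "A \<in> nsets {1..N} k")
        case True
        then have Ap: "A \<subseteq> {1..N}" "card A = k" "finite A" by (auto simp: nsets_def)
        have "N \<notin> A"
        proof
          assume "N \<in> A"
          then have "insert N {1..k - 1} \<in> G"
            by (intro shifted_on_initial[OF sh A Ap(2)]) (use Ap k3 N_big in auto)
          then show False using False by simp
        qed
        have "A \<subseteq> {1..N - 1}"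
        proof
          fix z assume "z \<in> A"
          then have "z \<in> {1..N}" "z \<noteq> N" using Ap \<open>N \<notin> A\<close> by blast+
          then show "z \<in> {1..N - 1}" by auto
        qed
        then show ?thesis using Ap by (auto simp: nsets_def)
      qed (use A in auto)
    qed
    have "card G \<le> card (nsets {1..N - 1} k \<union> (G - nsets {1..N} k))"
      using fG by (intro card_mono[OF _ sub]) (auto simp: finite_imp_finite_nsets)
    also have "\<dots> \<le> card (nsets {1..N - 1} k) + card (G - nsets {1..N} k)" by (rule card_Un_le)
    also have "\<dots> \<le> ((N - 1) choose k) + (N choose (k - 1))" using Gs(4) by simp
    also have "\<dots> = (N choose k) + ((N - 1) choose (k - 2))"
    proof -
      have "N choose k = ((N - 1) choose (k - 1)) + ((N - 1) choose k)"
        using choose_reduce_nat[of N k] k3 N_big by simp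
      moreover have "N choose (k - 1) = ((N - 1) choose (k - 2)) + ((N - 1) choose (k - 1))"
        using choose_reduce_nat[of N "k - 1"] k3 N_big by (simp add: numeral_2_eq_2)
      ultimately show ?thesis by simp
    qed
    also have "\<dots> \<le> nontrivial_bound k N (N + 2)"
      unfolding nontrivial_bound_def by (intro add_left_mono max.coboundedI2) simp
    finally show ?thesis using Gs(3) by simp
  next
    case True
    have all: "insert x {1..k - 1} \<in> G" if x: "k \<le> x" "x \<le> N + 2" for x
    proof (cases "x < N")
      case True
      have "insert x (insert N {1..k - 1} - {N}) \<in> G"
        by (rule shifted_onD[OF sh \<open>insert N {1..k - 1} \<in> G\<close>]) (use True x k3 N_big in auto)
      moreover have "insert N {1..k - 1} - {N} = {1..k - 1}" using N_big k3 by auto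
      ultimately show ?thesis by simp
    next
      case False
      then have "x = N \<or> x = N + 1 \<or> x = N + 2" using x by linarith
      then show ?thesis using \<open>insert N {1..k - 1} \<in> G\<close> init by blast
    qed
    \<comment> \<open>These sets cover all vertices, and every shift to the left keeps them: moving
      \<open>insert b {1..k - 1}\<close> to some \<open>a \<ge> k\<close> is blocked by
      \<open>insert a {1..k - 1}\<close>. So shifts involving \<open>N + 1\<close> and
      \<open>N + 2\<close> are now safe.\<close>
    define Inv' where "Inv' K \<longleftrightarrow> K \<subseteq> nsets {1..N + 2} k \<and> matching_le K s \<and> card K = card F
        \<and> (\<forall>x. k \<le> x \<longrightarrow> x \<le> N + 2 \<longrightarrow> insert x {1..k - 1} \<in> K)" for K
    have start: "Inv' G" unfolding Inv'_def using Gs all by blast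
    have fin: "finite K \<and> (\<forall>A\<in>K. finite A)" if "Inv' K" for K using that sub_fin unfolding Inv'_def by blast
    obtain K where K: "Inv' K" and stable': "\<And>a b. a < b \<Longrightarrow> Inv' (shift a b K) \<Longrightarrow> shift a b K = K"
      by (rule ex_shift_stable[of Inv', OF start fin]) (assumption | rule that)+
    have Ks: "K \<subseteq> nsets {1..N + 2} k" "matching_le K s" "card K = card F"
      "\<And>x. k \<le> x \<Longrightarrow> x \<le> N + 2 \<Longrightarrow> insert x {1..k - 1} \<in> K" using K unfolding Inv'_def by auto
    have fK: "finite K" using sub_fin Ks by blast
    have "shifted_on (N + 2) K"
    proof (rule shifted_on_of_fixed)
      fix a b :: nat assume ab: "1 \<le> a" "a < b" "b \<le> N + 2"
      have "insert x {1..k - 1} \<in> shift a b K" if x: "k \<le> x" "x \<le> N + 2" for x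
      proof -
        have "shift_set a b K (insert x {1..k - 1}) = insert x {1..k - 1}"
        proof (cases "b \<in> insert x {1..k - 1} \<and> a \<notin> insert x {1..k - 1}")
          case True
          then have "b = x" "k \<le> a" using ab by auto
          then have "insert a (insert x {1..k - 1} - {b}) = insert a {1..k - 1}" using ab k3 by auto
          moreover have "insert a {1..k - 1} \<in> K" using Ks(4) \<open>k \<le> a\<close> ab by simp
          ultimately show ?thesis unfolding shift_set_def by simp
        qed (auto simp: shift_set_def)
        then show ?thesis using Ks(4)[OF x] unfolding shift_def by (metis image_eqI)
      qed
      then have "Inv' (shift a b K)"
        unfolding Inv'_def using shift_nsets[OF Ks(1)] ab Ks(2,3)
        by (auto simp: card_shift matching_le_shift[OF fK])
      then show "shift a b K = K" using stable' ab by blast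
    qed
    then have "card K \<le> nontrivial_bound k N (N + 2)"
      using Ks N_big close by (intro shifted_bound) auto
    then show ?thesis using Ks(3) by simp
  qed
qed

text \<open>Isolating \<open>b\<close> means that every member containing \<open>b\<close> was
  moved: it omits \<open>a\<close>, and its exchange was not in \<open>F\<close>. Hence the links of
  \<open>a\<close> and \<open>b\<close> are disjoint families of \<open>(k - 1)\<close>-sets on the
  other \<open>N\<close> vertices, and renaming the pair to \<open>N + 1\<close>,
  \<open>N + 2\<close> leads to \<open>base_bound\<close>.\<close>

lemma isolating_shift_base:
  assumes close: "close_to (N + 2)" and F: "F \<subseteq> nsets {1..N + 2} k" "matching_le F s"
    "\<Union>F = {1..N + 2}" and ab: "a < b" "a \<in> {1..N + 2}" "b \<in> {1..N + 2}" and iso: "b \<notin> \<Union>(shift a b F)"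
  shows "card F \<le> nontrivial_bound k N (N + 2)"
proof -
  let ?V = "{1..N + 2}"
  have fF: "finite F" using finite_subset[OF F(1) finite_imp_finite_nsets] by simp
  have moved: "a \<notin> A \<and> insert a (A - {b}) \<notin> F" if A: "A \<in> F" "b \<in> A" for A
  proof (rule ccontr)
    assume "\<not> ?thesis"
    then have "shift_set a b F A = A" unfolding shift_set_def by auto
    then have "A \<in> shift a b F" using A(1) unfolding shift_def by (metis image_eqI)
    then show False using iso A(2) by blast
  qed
  have "card (?V - {a, b}) = card {1..N}" using ab by (subst card_Diff_subset) auto
  then obtain g where g: "bij_betw g (?V - {a, b}) {1..N}"
    using finite_same_card_bij[of "?V - {a, b}" "{1..N}"] by auto
  define f where "f x = (if x = a then N + 1 else if x = b then N + 2 else g x)" for x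
  have gim: "g x \<in> {1..N}" if "x \<in> ?V - {a, b}" for x
    using g that by (auto simp: bij_betw_def)
  have injf: "inj_on f ?V"
  proof (rule inj_onI)
    fix x y assume xy: "x \<in> ?V" "y \<in> ?V" "f x = f y"
    have gne: "g z \<noteq> N + 1 \<and> g z \<noteq> N + 2" if "z \<in> ?V - {a, b}" for z
      using gim[OF that] by auto
    have ginj: "g x = g y \<Longrightarrow> x \<in> ?V - {a, b} \<Longrightarrow> y \<in> ?V - {a, b} \<Longrightarrow> x = y"
      using g unfolding bij_betw_def inj_on_def by blast
    show "x = y"
      using xy gne[of x] gne[of y] ginj ab unfolding f_def by (auto split: if_splits)
  qed
  have fV: "f ` ?V \<subseteq> ?V"
  proof
    fix z assume "z \<in> f ` ?V"
    then obtain x where x: "x \<in> ?V" "z = f x" by blast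
    show "z \<in> ?V"
    proof (cases "x \<in> {a, b}")
      case False
      then show ?thesis using gim[of x] x by (auto simp: f_def)
    qed (use x in \<open>auto simp: f_def\<close>)
  qed
  have fle: "f x \<le> N" "f x \<ge> 1" if "x \<in> ?V" "x \<noteq> a" "x \<noteq> b" for x
    using gim[of x] that by (auto simp: f_def)
  define G where "G = (`) f ` F"
  have FP: "F \<subseteq> Pow ?V" using F(1) by (auto simp: nsets_def)
  have injF: "inj_on ((`) f) F" by (rule inj_on_subset[OF inj_on_image_Pow[OF injf] FP])
  have cG: "card G = card F" unfolding G_def by (rule card_image[OF injF])
  define Oab where "Oab = {A \<in> F. a \<in> A \<or> b \<in> A}"
  have "card Oab \<le> card (nsets (?V - {a, b}) (k - 1))"
  proof (rule card_inj_on_le)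
    \<comment> \<open>By \<open>moved\<close> a member of \<open>Oab\<close> contains exactly one of
      \<open>a\<close>, \<open>b\<close>, and its other vertices determine which.\<close>
    show "inj_on (\<lambda>A. A - {a, b}) Oab"
    proof (rule inj_onI)
      fix A B assume AB: "A \<in> Oab" "B \<in> Oab" "A - {a, b} = B - {a, b}"
      have A: "A \<in> F" "a \<in> A \<or> b \<in> A" and B: "B \<in> F" "a \<in> B \<or> b \<in> B" using AB unfolding Oab_def by auto
      have "(b \<in> A) = (b \<in> B)"
      proof (rule ccontr)
        assume "(b \<in> A) \<noteq> (b \<in> B)"
        then consider "b \<in> A" "b \<notin> B" "a \<in> B" | "b \<in> B" "b \<notin> A" "a \<in> A" using A B by blast
        then show False
        proof cases
          case 1
          have "insert a (A - {b}) = B" using 1 moved[OF A(1) 1(1)] AB(3) by blast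
          then show False using moved[OF A(1) 1(1)] B by simp
        next
          case 2
          have "insert a (B - {b}) = A" using 2 moved[OF B(1) 2(1)] AB(3) by blast
          then show False using moved[OF B(1) 2(1)] A by simp
        qed
      qed
      then show "A = B" using AB(3) A B moved[of A] moved[of B] by blast
    qed
    show "(\<lambda>A. A - {a, b}) ` Oab \<subseteq> nsets (?V - {a, b}) (k - 1)"
    proof
      fix X assume "X \<in> (\<lambda>A. A - {a, b}) ` Oab"
      then obtain A where A: "A \<in> F" "a \<in> A \<or> b \<in> A" "X = A - {a, b}" unfolding Oab_def by blast
      have Ap: "A \<subseteq> ?V" "finite A" "card A = k" using A(1) F(1) by (auto simp: nsets_def)
      obtain c where c: "c \<in> A" "A - {a, b} = A - {c}"
        using A(2) moved[OF A(1)] by blast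
      then have "card (A - {a, b}) = k - 1" using Ap by simp
      then show "X \<in> nsets (?V - {a, b}) (k - 1)" using A(3) Ap by (auto simp: nsets_def)
    qed
  qed (simp add: finite_imp_finite_nsets)
  then have cO: "card Oab \<le> N choose (k - 1)" using \<open>card (?V - {a, b}) = card {1..N}\<close> by simp
  have "G - nsets {1..N} k \<subseteq> (`) f ` Oab"
  proof
    fix X assume X: "X \<in> G - nsets {1..N} k"
    then obtain A where A: "A \<in> F" "X = f ` A" unfolding G_def by blast
    have An: "A \<in> nsets ?V k" using A F(1) by blast
    then have Ap: "A \<subseteq> ?V" "finite A" "card A = k" by (auto simp: nsets_def)
    have "a \<in> A \<or> b \<in> A"
    proof (rule ccontr)
      assume no: "\<not> ?thesis"
      have "f ` A \<subseteq> {1..N}"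
      proof
        fix z assume "z \<in> f ` A"
        then obtain x where "x \<in> A" "z = f x" by blast
        then show "z \<in> {1..N}" using fle[of x] no Ap(1) by (metis atLeastAtMost_iff subsetD)
      qed
      then have "X \<in> nsets {1..N} k"
        using A Ap card_image[OF inj_on_subset[OF injf Ap(1)]] by (auto simp: nsets_def)
      then show False using X by blast
    qed
    then show "X \<in> (`) f ` Oab" using A unfolding Oab_def by blast
  qed
  then have "card (G - nsets {1..N} k) \<le> card ((`) f ` Oab)"
    using fF unfolding Oab_def by (intro card_mono) auto
  also have "\<dots> \<le> card Oab" using fF unfolding Oab_def by (intro card_image_le) auto
  finally have out: "card (G - nsets {1..N} k) \<le> N choose (k - 1)" using cO by simp
  have fa: "f x = N + 1 \<longleftrightarrow> x = a" "f x = N + 2 \<longleftrightarrow> x = b" if "x \<in> ?V" for x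
    using fle[of x] that ab unfolding f_def by (auto split: if_splits)
  have fim: "f ` A \<inter> {N + 1, N + 2} = {x. x = N + 1 \<and> a \<in> A \<or> x = N + 2 \<and> b \<in> A}"
    if A: "A \<subseteq> ?V" for A
  proof -
    have "f a = N + 1" "f b = N + 2" using ab unfolding f_def by auto
    then have "N + 1 \<in> f ` A \<longleftrightarrow> a \<in> A" "N + 2 \<in> f ` A \<longleftrightarrow> b \<in> A"
      using A fa by (metis imageE image_eqI subsetD)+
    then show ?thesis
      by (intro set_eqI) (simp, metis)
  qed
  have "card G \<le> nontrivial_bound k N (N + 2)"
  proof (rule base_bound[OF close _ _ out])
    show "G \<subseteq> nsets ?V k"
    proof
      fix X assume "X \<in> G"
      then obtain A where A: "A \<in> F" "X = f ` A" unfolding G_def by blast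
      then have "X \<in> nsets (f ` ?V) k" using nsets_image[OF injf] F(1) by blast
      then show "X \<in> nsets ?V k" using nsets_mono[OF fV] by blast
    qed
    show "matching_le G s" unfolding G_def by (rule matching_le_image[OF injf FP F(2)])
    obtain A where A: "A \<in> F" "a \<in> A" using F(3) ab(2) by blast
    have "b \<notin> A" using moved[OF A(1)] A(2) by blast
    have "A \<subseteq> ?V" using A FP by blast
    then have "f ` A \<inter> {N + 1, N + 2} = {N + 1}" using fim A(2) \<open>b \<notin> A\<close> by simp
    then show "\<exists>A\<in>G. A \<inter> {N + 1, N + 2} = {N + 1}" using A(1) unfolding G_def by blast
    obtain B where B: "B \<in> F" "b \<in> B" using F(3) ab(3) by blast
    have "a \<notin> B" using moved[OF B] by blast
    have "B \<subseteq> ?V" using B FP by blast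
    then have "f ` B \<inter> {N + 1, N + 2} = {N + 2}" using fim B(2) \<open>a \<notin> B\<close> by simp
    then show "\<exists>A\<in>G. A \<inter> {N + 1, N + 2} = {N + 2}" using B(1) unfolding G_def by blast
  qed
  then show ?thesis using cG by simp
qed

text \<open>Take a stable family among the covering ones. If some shift to the left changes it, that
  shift must break coverage, and the only vertex it can lose is \<open>b\<close>.\<close>

lemma shifted_or_isolating:
  assumes "n \<ge> N + 2" "close_to n" "F \<subseteq> nsets {1..n} k" "\<Union>F = {1..n}" "matching_le F s"
  obtains "card F \<le> nontrivial_bound k N n"
  | G a b where "G \<subseteq> nsets {1..n} k" "\<Union>G = {1..n}" "matching_le G s" "card G = card F"
      "a < b" "a \<in> {1..n}" "b \<in> {1..n}" "\<Union>(shift a b G) = {1..n} - {b}"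
proof -
  define Inv where "Inv G \<longleftrightarrow> G \<subseteq> nsets {1..n} k \<and> \<Union>G = {1..n} \<and> matching_le G s \<and> card G = card F" for G
  have sub_fin: "finite G \<and> (\<forall>A\<in>G. finite A)" if "G \<subseteq> nsets {1..n} k" for G
    using that finite_subset[OF that finite_imp_finite_nsets] by (auto simp: nsets_def)
  have start: "Inv F" unfolding Inv_def using assms by blast
  have fin: "finite G \<and> (\<forall>A\<in>G. finite A)" if "Inv G" for G using that sub_fin unfolding Inv_def by blast
  obtain G where G: "Inv G" and stable: "\<And>a b. a < b \<Longrightarrow> Inv (shift a b G) \<Longrightarrow> shift a b G = G"
    by (rule ex_shift_stable[of Inv, OF start fin]) (assumption | rule that)+
  have Gs: "G \<subseteq> nsets {1..n} k" "\<Union>G = {1..n}" "matching_le G s" "card G = card F"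
    using G unfolding Inv_def by auto
  have fG: "finite G" using sub_fin Gs by blast
  show thesis
  proof (cases "\<forall>a b. 1 \<le> a \<longrightarrow> a < b \<longrightarrow> b \<le> n \<longrightarrow> shift a b G = G")
    case True
    then have sh: "shifted_on n G" by (intro shifted_on_of_fixed) auto
    have "n \<in> \<Union>G" using Gs(2) assms(1) by simp
    then obtain A where A: "A \<in> G" "n \<in> A" by blast
    have Ap: "A \<subseteq> {1..n}" "card A = k" using A Gs(1) by (auto simp: nsets_def)
    have "insert n {1..k - 1} \<in> G"
      by (rule shifted_on_initial[OF sh A(1) Ap(2) _ A(2) Ap(1)]) (use Ap k3 N_big assms(1) in auto)
    then have "card G \<le> nontrivial_bound k N n" by (rule shifted_bound[OF assms(1,2) Gs(1) sh Gs(3)])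
    then show thesis using that(1) Gs(4) by simp
  next
    case False
    then obtain a b where ab: "1 \<le> a" "a < b" "b \<le> n" "shift a b G \<noteq> G" by blast
    then have abn: "a \<in> {1..n}" "b \<in> {1..n}" by auto
    have "\<not> Inv (shift a b G)" using stable ab by blast
    moreover have shn: "shift a b G \<subseteq> nsets {1..n} k" by (rule shift_nsets[OF Gs(1) abn(1)])
    ultimately have ne: "\<Union>(shift a b G) \<noteq> {1..n}"
      using Gs(4) matching_le_shift[OF fG Gs(3)] unfolding Inv_def by (auto simp: card_shift)
    have "{1..n} - {b} \<subseteq> \<Union>(shift a b G)"
    proof
      fix x assume x: "x \<in> {1..n} - {b}"
      then obtain A where A: "A \<in> G" "x \<in> A" using Gs(2) by blast
      then have "x \<in> shift_set a b G A" using x unfolding shift_set_def by auto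
      then show "x \<in> \<Union>(shift a b G)" using A unfolding shift_def by blast
    qed
    moreover have "\<Union>(shift a b G) \<subseteq> {1..n}" using shn by (auto simp: nsets_def)
    ultimately have "\<Union>(shift a b G) = {1..n} - {b}" using ne by blast
    then show thesis using that(2)[OF Gs ab(2) abn] by blast
  qed
qed

text \<open>Stated for any \<open>V\<close> of the right size since the induction step removes
  \<open>b\<close> from the ground set; there the isolating shift is again a covering family of the
  same cardinality.\<close>

lemma nontrivial_card_le:
  fixes V :: "nat set"
  assumes "finite V" "card V = N + 2 + m" "close_to (N + 2 + m)" "F \<subseteq> nsets V k" "\<Union>F = V" "matching_le F s"
  shows "card F \<le> nontrivial_bound k N (N + 2 + m)"
  using assms
proof (induction m arbitrary: V F)
  case (0 V F)
  obtain f where f: "bij_betw f V {1..N + 2}"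
    using finite_same_card_bij[OF 0(1), of "{1..N + 2}"] 0(2) by auto
  note rl = relabel[OF f 0(4-6)]
  have cl: "close_to (N + 2)" using 0(3) by simp
  have "card ((`) f ` F) \<le> nontrivial_bound k N (N + 2)"
  proof (cases rule: shifted_or_isolating[OF order_refl cl rl(1-3)])
    case (2 G a b)
    then show ?thesis using isolating_shift_base[of G a b] cl by simp
  qed
  then show ?case using rl(4) by simp
next
  case (Suc m V F)
  let ?n = "N + 2 + Suc m"
  obtain f where f: "bij_betw f V {1..?n}"
    using finite_same_card_bij[OF Suc.prems(1), of "{1..?n}"] Suc.prems(2) by auto
  note rl = relabel[OF f Suc.prems(4-6)]
  have le: "N + 2 \<le> ?n" by simp
  have "card ((`) f ` F) \<le> nontrivial_bound k N ?n"
  proof (cases rule: shifted_or_isolating[OF le Suc.prems(3) rl(1-3)])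
    case (2 G a b)
    note 3 = 2
    have fG: "finite G" using finite_subset[OF 3(1) finite_imp_finite_nsets] by simp
    have "shift a b G \<subseteq> nsets {1..?n} k" by (rule shift_nsets[OF 3(1) 3(6)])
    then have "shift a b G \<subseteq> nsets ({1..?n} - {b}) k" using 3(8) unfolding nsets_def by blast
    moreover have "close_to (N + 2 + m)" by (rule close_to_mono[OF Suc.prems(3)]) simp
    moreover have "card ({1..?n} - {b}) = N + 2 + m" using 3(7) by simp
    ultimately have "card (shift a b G) \<le> nontrivial_bound k N (N + 2 + m)"
      using 3(8) matching_le_shift[OF fG 3(3)] by (intro Suc.IH[of "{1..?n} - {b}"]) auto
    also have "\<dots> \<le> nontrivial_bound k N ?n" by (rule nontrivial_bound_mono) simp
    finally show ?thesis using 3(4) by (simp add: card_shift)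
  qed
  then show ?case using rl(4) by simp
qed

end

subsection \<open>Cardinalities of the extremal families\<close>

lemma card_insert_image:
  assumes "\<And>B. B \<in> \<B> \<Longrightarrow> x \<notin> B"
  shows "card (insert x ` \<B>) = card \<B>"
proof (rule card_image, rule inj_onI)
  fix A B assume "A \<in> \<B>" "B \<in> \<B>" "insert x A = insert x B"
  then show "A = B" using assms by (metis insert_ident)
qed

text \<open>The three parts are told apart by their traces outside \<open>{1..N}\<close>, so their
  sizes add up.\<close>

lemma card_E0:
  assumes "k \<ge> 3" "N = k * s + k - 2" "n \<ge> N + 2" "k \<le> N"
  shows "card (E0 n k s) \<ge> (N choose k) +
    ((N choose (k - 1)) - ((N - (k - 1)) choose (k - 1)) + (n - N - 1))"
proof -
  let ?X1 = "nsets {1..N} k"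
  define H where "H = {B \<in> nsets {1..N} (k - 1). B \<inter> {1..k - 1} \<noteq> {}}"
  let ?X2 = "insert (N + 1) ` H"
  let ?X3 = "(\<lambda>x. {1..k - 1} \<union> {x}) ` {N + 2..n}"
  have Neq: "k * s + k - 2 = N" "k * s + k - 1 = N + 1" "k * s + k = N + 2" using assms(1,2) by auto
  have Hp: "B \<subseteq> {1..N} \<and> finite B \<and> card B = k - 1 \<and> B \<inter> {1..k - 1} \<noteq> {}" if "B \<in> H" for B
    using that unfolding H_def nsets_def by blast
  have tr1: "A - {1..N} = {}" if "A \<in> ?X1" for A using that unfolding nsets_def by blast
  have tr2: "A - {1..N} = {N + 1}" if "A \<in> ?X2" for A using that Hp by auto
  have tr3: "\<exists>x\<in>{N + 2..n}. A - {1..N} = {x}" if "A \<in> ?X3" for A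
    using that assms(4) by auto
  have fin: "finite ?X1" "finite H" unfolding H_def by (auto simp: finite_imp_finite_nsets)
  have "?X1 \<union> ?X2 \<union> ?X3 \<subseteq> E0 n k s"
  proof -
    have "?X2 \<subseteq> {A \<in> nsets {1..n} k. A - {1..N} = {N + 1} \<and> A \<inter> {1..k - 1} \<noteq> {}}"
    proof
      fix A assume A: "A \<in> ?X2"
      then obtain B where B: "B \<in> H" "A = insert (N + 1) B" by blast
      then have Bp: "B \<subseteq> {1..N}" "finite B" "card B = k - 1" "B \<inter> {1..k - 1} \<noteq> {}" using Hp by blast+
      then have "N + 1 \<notin> B" by auto
      then have "card A = k" using Bp B(2) assms(1) by simp
      moreover have "A \<subseteq> {1..n}" using B(2) Bp(1) assms(3) by auto
      moreover have "A \<inter> {1..k - 1} \<noteq> {}" using Bp(4) B(2) by blast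
      ultimately show "A \<in> {A \<in> nsets {1..n} k. A - {1..N} = {N + 1} \<and> A \<inter> {1..k - 1} \<noteq> {}}"
        using tr2[OF A] Bp B(2) by (simp add: nsets_def)
    qed
    moreover have "?X3 \<subseteq> {{1..k - 1} \<union> {x} | x. N + 2 \<le> x \<and> x \<le> n}" by auto
    ultimately show ?thesis unfolding E0_def Neq by (intro Un_mono) auto
  qed
  moreover have "finite (E0 n k s)"
  proof (rule finite_subset[of _ "Pow {1..n}"])
    show "E0 n k s \<subseteq> Pow {1..n}"
      unfolding E0_def Neq using assms(3,4) by (fastforce simp: nsets_def)
  qed simp
  ultimately have "card (?X1 \<union> ?X2 \<union> ?X3) \<le> card (E0 n k s)" by (intro card_mono)
  moreover have "card (?X1 \<union> ?X2 \<union> ?X3) = card ?X1 + card ?X2 + card ?X3"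
  proof -
    have "?X1 \<inter> ?X2 = {}" using tr1 tr2 by blast
    moreover have "(?X1 \<union> ?X2) \<inter> ?X3 = {}"
    proof (rule ccontr)
      assume "(?X1 \<union> ?X2) \<inter> ?X3 \<noteq> {}"
      then obtain A where A: "A \<in> ?X1 \<or> A \<in> ?X2" "A \<in> ?X3" by blast
      obtain x where "x \<in> {N + 2..n}" "A - {1..N} = {x}" using tr3[OF A(2)] by blast
      then show False using A(1) tr1[of A] tr2[of A] by auto
    qed
    ultimately show ?thesis using fin by (simp add: card_Un_disjoint)
  qed
  moreover have "card ?X2 = (N choose (k - 1)) - ((N - (k - 1)) choose (k - 1))"
  proof -
    have "card ?X2 = card H" by (rule card_insert_image) (use Hp in force)
    also have "\<dots> = (N choose (k - 1)) - ((N - (k - 1)) choose (k - 1))"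
    proof -
      have "{1..k - 1} \<subseteq> {1..N}" using assms(4) by auto
      then show ?thesis
        unfolding H_def using card_nsets_meeting[of "{1..N}" "{1..k - 1}" "k - 1"] by simp
    qed
    finally show ?thesis .
  qed
  moreover have "card ?X3 = n - N - 1"
  proof -
    have "inj_on (\<lambda>x. {1..k - 1} \<union> {x}) {N + 2..n}"
    proof (rule inj_onI)
      fix x y assume "x \<in> {N + 2..n}" "y \<in> {N + 2..n}" "{1..k - 1} \<union> {x} = {1..k - 1} \<union> {y}"
      then have "x \<in> {1..k - 1} \<union> {y}" "x > k - 1" using assms(4) by auto
      then show "x = y" by auto
    qed
    then show ?thesis by (simp add: card_image)
  qed
  ultimately show ?thesis by simp
qed

text \<open>Each outer vertex \<open>x\<close> carries a copy of the star of \<open>1\<close>, and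
  the trace outside \<open>{1..N}\<close> recovers \<open>x\<close>.\<close>

lemma card_E1:
  assumes "k \<ge> 3" "N = k * s + k - 2" "n \<ge> N + 2" "k \<le> N"
  shows "card (E1 n k s) \<ge> (N choose k) + (n - N) * ((N - 1) choose (k - 2))"
proof -
  let ?X1 = "nsets {1..N} k"
  define H where "H = {B \<in> nsets {1..N} (k - 1). {1} \<subseteq> B}"
  let ?X2 = "\<Union>x\<in>{N + 1..n}. insert x ` H"
  have Neq: "k * s + k - 2 = N" "k * s + k - 1 = N + 1" using assms(1,2) by auto
  have Hp: "B \<subseteq> {1..N} \<and> finite B \<and> card B = k - 1 \<and> 1 \<in> B" if "B \<in> H" for B
    using that unfolding H_def nsets_def by blast
  have tr: "A - {1..N} = {x}" if "A \<in> insert x ` H" "x \<in> {N + 1..n}" for A x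
    using that Hp by auto
  have fin: "finite ?X1" "finite H" unfolding H_def by (auto simp: finite_imp_finite_nsets)
  have "?X1 \<union> ?X2 \<subseteq> E1 n k s"
  proof -
    have "insert x ` H \<subseteq> {A \<in> nsets {1..n} k. A - {1..N} = {x} \<and> 1 \<in> A}" if x: "x \<in> {N + 1..n}" for x
    proof
      fix A assume A: "A \<in> insert x ` H"
      then obtain B where B: "B \<in> H" "A = insert x B" by blast
      then have Bp: "B \<subseteq> {1..N}" "finite B" "card B = k - 1" "1 \<in> B" using Hp by blast+
      then have "x \<notin> B" using x by auto
      then have "card A = k" using Bp B(2) assms(1) by simp
      moreover have "A \<subseteq> {1..n}" using B(2) Bp(1) x by auto
      ultimately show "A \<in> {A \<in> nsets {1..n} k. A - {1..N} = {x} \<and> 1 \<in> A}"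
        using tr[OF A x] Bp B(2) by (simp add: nsets_def)
    qed
    then show ?thesis unfolding E1_def Neq by blast
  qed
  moreover have "finite (E1 n k s)"
  proof (rule finite_subset[of _ "Pow {1..n}"])
    show "E1 n k s \<subseteq> Pow {1..n}"
      unfolding E1_def Neq using assms(3,4) by (fastforce simp: nsets_def)
  qed simp
  ultimately have "card (?X1 \<union> ?X2) \<le> card (E1 n k s)" by (intro card_mono)
  moreover have "card (?X1 \<union> ?X2) = card ?X1 + card ?X2"
  proof -
    have "?X1 \<inter> ?X2 = {}"
    proof (rule ccontr)
      assume "?X1 \<inter> ?X2 \<noteq> {}"
      then obtain A x where "A \<in> ?X1" "x \<in> {N + 1..n}" "A \<in> insert x ` H" by blast
      then show False using tr[of A x] unfolding nsets_def by blast
    qed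
    then show ?thesis using fin by (intro card_Un_disjoint) auto
  qed
  moreover have "card ?X2 = (n - N) * ((N - 1) choose (k - 2))"
  proof -
    have "card ?X2 = (\<Sum>x\<in>{N + 1..n}. card (insert x ` H))"
    proof (rule card_UN_disjoint)
      show "\<forall>x\<in>{N + 1..n}. \<forall>y\<in>{N + 1..n}. x \<noteq> y \<longrightarrow> insert x ` H \<inter> insert y ` H = {}"
      proof (intro ballI impI)
        fix x y assume xy: "x \<in> {N + 1..n}" "y \<in> {N + 1..n}" "x \<noteq> y"
        show "insert x ` H \<inter> insert y ` H = {}"
        proof (rule ccontr)
          assume "insert x ` H \<inter> insert y ` H \<noteq> {}"
          then obtain A where "A \<in> insert x ` H" "A \<in> insert y ` H" by blast
          then show False using tr xy by (metis singleton_inject)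
        qed
      qed
    qed (use fin in auto)
    also have "\<dots> = (\<Sum>x\<in>{N + 1..n}. card H)"
    proof (rule sum.cong)
      fix x assume x: "x \<in> {N + 1..n}"
      show "card (insert x ` H) = card H" by (rule card_insert_image) (use x Hp in force)
    qed simp
    also have "card H = (N - 1) choose (k - 1 - 1)"
      unfolding H_def using card_nsets_superset[of "{1..N}" "{1}" "k - 1"] assms(1,4) by simp
    finally show ?thesis by (simp add: numeral_2_eq_2)
  qed
  ultimately show ?thesis by simp
qed


section \<open>Choice of the constants\<close>

theorem theorem1p6:
  fixes k :: nat
  assumes "k \<ge> 3"
  shows "\<exists>(\<beta>::real) (s0::nat). \<beta> > 0 \<and> s0 > 0 \<and>
           (\<forall>(n::nat) (s::nat) (F :: nat set set).
              s > s0 \<longrightarrow>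
              k*s + k \<le> n \<longrightarrow>
              real n \<le> (1 + \<beta>) * real k * real s + real k - 2 \<longrightarrow>
              F \<subseteq> nsets {1..n} k \<longrightarrow>
              nontrivial n F \<longrightarrow>
              matching_number F \<le> s \<longrightarrow>
              card F \<le> max (card (E0 n k s)) (card (E1 n k s)))"
proof -
  \<comment> \<open>The constant of \<open>close_to\<close>; with \<open>\<beta> = 1 / c\<close> the
    range of \<open>n\<close> becomes \<open>c * (n - N) \<le> k * s\<close>.\<close>
  define c where "c = 16 * 2 ^ k * (2 * k) ^ k * (2 * k * k)"
  \<comment> \<open>Makes \<open>N - 1\<close> at least
    \<open>(k - 2) * (4 * ((k - 1) * (k - 1)))\<close>, as \<open>binom\<close> requires; the
    summand 3 ensures \<open>s \<ge> 4\<close> and so \<open>4 * k \<le> N\<close>.\<close>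
  define s0 where "s0 = 4 * ((k - 1) * (k - 1)) * k + 3"
  have c0: "real c > 0" unfolding c_def using assms by simp
  have main: "card F \<le> max (card (E0 n k s)) (card (E1 n k s))"
    if s: "s > s0" and n: "k * s + k \<le> n"
      and n_le: "real n \<le> (1 + 1 / real c) * real k * real s + real k - 2"
      and F: "F \<subseteq> nsets {1..n} k" and nt: "nontrivial n F" and mn: "matching_number F \<le> s"
    for n s and F :: "nat set set"
  proof -
    define N where "N = k * s + k - 2"
    have N2: "N + 2 = k * s + k" using assms unfolding N_def by simp
    have ks: "k * s \<le> N" "s \<le> k * s" using N2 assms by auto
    have "k * 4 \<le> k * s" using s unfolding s0_def by (intro mult_le_mono2) simp
    then have N_big: "4 * k \<le> N" using ks(1) by linarith
    have binom: "4 * ((k - 1) * (k - 1)) * ((N - 2) choose (k - 3)) \<le> (N - 1) choose (k - 2)"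
    proof -
      \<comment> \<open>Absorption identity: the ratio of the two binomials is
        \<open>(N - 1) / (k - 2)\<close>.\<close>
      have "(k - 2) * ((N - 1) choose (k - 2)) = (N - 1) * ((N - 2) choose (k - 3))"
        using times_binomial_minus1_eq[of "k - 2" "N - 1"] assms by (simp add: numeral_2_eq_2 numeral_3_eq_3)
      moreover have "(k - 2) * (4 * ((k - 1) * (k - 1))) \<le> N - 1"
      proof -
        have "(k - 2) * (4 * ((k - 1) * (k - 1))) \<le> 4 * ((k - 1) * (k - 1)) * k"
          by (simp add: mult.commute)
        also have "\<dots> \<le> N - 1" using s ks unfolding s0_def by linarith
        finally show ?thesis .
      qed
      then have "(k - 2) * (4 * ((k - 1) * (k - 1))) * ((N - 2) choose (k - 3))
          \<le> (N - 1) * ((N - 2) choose (k - 3))" by (rule mult_le_mono1)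
      ultimately have "(k - 2) * (4 * ((k - 1) * (k - 1)) * ((N - 2) choose (k - 3)))
          \<le> (k - 2) * ((N - 1) choose (k - 2))" by (simp add: mult.assoc)
      then show ?thesis using assms by simp
    qed
    interpret large_matching_bound k s N
      using assms s N_big binom by unfold_locales (auto simp: N_def s0_def)
    have close: "close_to n"
    proof -
      have "real (n - N) = real n - (real k * real s + real k - 2)"
      proof -
        have "real N + 2 = real k * real s + real k" using arg_cong[OF N2, of real] by simp
        moreover have "N \<le> n" using n N2 by simp
        ultimately show ?thesis by (simp add: of_nat_diff)
      qed
      also have "\<dots> \<le> real k * real s / real c" using n_le by (simp add: algebra_simps)
      finally have "real c * real (n - N) \<le> real (k * s)" using c0 by (simp add: field_simps)
      then have "c * (n - N) \<le> k * s" by (metis of_nat_le_iff of_nat_mult)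
      then show ?thesis using ks unfolding close_to_def c_def by linarith
    qed
    have cov: "\<Union>F = {1..n}" using F nt unfolding nontrivial_def nsets_def by blast
    have match: "matching_le F s"
      by (rule matching_le_matching_number[OF finite_subset[OF F finite_imp_finite_nsets] mn]) simp
    obtain m where m: "n = N + 2 + m" using n N2 le_Suc_ex by metis
    have "card F \<le> nontrivial_bound k N (N + 2 + m)"
      by (rule nontrivial_card_le[OF _ _ close[unfolded m] F cov match]) (simp_all add: m)
    then have "card F \<le> nontrivial_bound k N n" unfolding m .
    also have "\<dots> \<le> max (card (E0 n k s)) (card (E1 n k s))"
      unfolding nontrivial_bound_def nat_add_max_right
      using card_E0[OF assms N_def, of n] card_E1[OF assms N_def, of n] n N2 N_big
      by (intro max.mono) linarith+
    finally show ?thesis .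
  qed
  show ?thesis
  proof (intro exI conjI allI impI)
    show "1 / real c > 0" using c0 by simp
    show "s0 > 0" unfolding s0_def by simp
  qed (rule main)
qed

end
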